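(* For $x\in\Sigma$, the counit map $p_x:\underline{\mathrm{Cub}}(\uparrow\! x\!\uparrow)\to\,\uparrow\! x\!\uparrow$ is not a weak equivalence in the left determined model structure of $\mathbf{CTS}$.
   Context: Fix a nonempty set $\Sigma$ (of labels). A weak higher dimensional transition system (weak HDTS) is a triple $(S,\mu:L\to\Sigma,T=\bigcup_{n\ge 1}T_n)$ where $S$ is a set (states), $L$ a set (actions), $\mu$ a set map (labelling map), $T_n\subset S\times L^n\times S$ (the $n$-transitions) such that: (Multiset axiom) if $(\alpha,u_1,\dots,u_n,\beta)\in T$, $n\ge 2$, then $(\alpha,u_{\sigma(1)},\dots,u_{\sigma(n)},\beta)\in T$ for every permutation $\sigma$; (Coherence axiom) for $n\ge 3$, $p,q\ge 1$, $p+q<n$, if $(\alpha,u_1,\dots,u_n,\beta)$, $(\alpha,u_1,\dots,u_p,\nu_1)$, $(\nu_1,u_{p+1},\dots,u_n,\beta)$, $(\alpha,u_1,\dots,u_{p+q},\nu_2)$, $(\nu_2,u_{p+q+1},\dots,u_n,\beta)$ are all transitions, then $(\nu_1,u_{p+1},\dots,u_{p+q},\nu_2)$ is a transition. A map $f$ of weak HDTS consists of a map $f_0$ on states and a label-preserving map $\widetilde f$ on actions carrying transitions to transitions. The category is $\mathbf{WHDTS}$. For $n\ge 0$ and $x_1,\dots,x_n\in\Sigma$, the $n$-cube $C_n[x_1,\dots,x_n]$ has states $\{0,1\}^n$, actions $\{(x_1,1),\dots,(x_n,n)\}$ with $\mu(x_i,i)=x_i$, and transitions all tuples $((\epsilon_1,\dots,\epsilon_n),(x_{i_1},i_1),\dots,(x_{i_d},i_d),(\epsilon'_1,\dots,\epsilon'_n))$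 with $d\geq 1$, $i_1,\dots,i_d$ pairwise distinct, $\epsilon_i\le\epsilon'_i$ for all $i$, and $\epsilon_i\ne\epsilon'_i$ iff $i\in\{i_1,\dots,i_d\}$. A subcube of $X$ is the image (smallest subobject through which the map factors) of a map $C_n[x_1,\dots,x_n]\to X$. A weak HDTS is a cubical transition system if it equals the union (least upper bound in its poset of subobjects) of its subcubes. $\mathbf{CTS}\subset\mathbf{WHDTS}$ is the full (coreflective, locally presentable) subcategory of cubical transition systems. For $x\in\Sigma$, the double transition $\uparrow\! x\!\uparrow$ is the (cubical) weak HDTS with states $\{1,2,3,4\}$, one action $x$ labelled by $x$, and two transitions $(1,x,2)$ and $(3,x,4)$. The cubification functor is $\underline{\mathrm{Cub}}(X)=\varinjlim_{C_n[x_1,\dots,x_n]\to X}C_n[x_1,\dots,x_n]$ (colimit over the category of all cubes of $X$), with canonical map (counit) $p_X:\underline{\mathrm{Cub}}(X)\to X$; $p_x$ denotes $p_X$ for $X=\,\uparrow\! x\!\uparrow$. One has $\underline{\mathrm{Cub}}(\uparrow\! x\!\uparrow)\cong C_1[x]\sqcup C_1[x]$. A cofibration of cubical transition systems is a map $f$ of $\mathbf{CTS}$ such that $\widetilde f$ is injective on actions. For a class $\mathcal A$ of maps of a category, an $\mathcal A$-localizer is a class $\mathcal W$ of maps satisfying two-out-of-three, containing all maps with the right lifting property with respect to $\mathcal A$, and such that $\mathcal A\cap\mathcal W$ is closed under pushout and transfinite composition. The left determined model structure of $\mathbf{CTS}$ is the model structure (which exists and is unique) whose cofibrations are the cofibrations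 of cubical transition systems and whose weak equivalences form the smallest localizer of $\mathbf{CTS}$ with respect to this class of cofibrations. *)

theory Defs
  imports
    "HOL-Library.FuncSet"
    "HOL-Library.Equipollence"
    "HOL-Combinatorics.Permutations"
begin

section \<open>Weak higher dimensional transition systems\<close>

text \<open>
  The nonempty set \<open>\<Sigma>\<close> of labels is the type \<open>'l\<close>. The transition
  \<open>(\<alpha>, u\<^sub>1, \<dots>, u\<^sub>n, \<beta>)\<close> is encoded as the triple \<open>(\<alpha>, [u\<^sub>1, \<dots>, u\<^sub>n], \<beta>)\<close>, so that \<open>T\<^sub>n\<close>
  is the set of transitions whose list has length \<open>n\<close>.
\<close>

record ('s, 'a, 'l) whdts =
  states :: "'s set"
  actions :: "'a set"
  label :: "'a \<Rightarrow> 'l"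
  transitions :: "('s \<times> 'a list \<times> 's) set"

text \<open>
  The labelling map is required to be undefined outside the set of actions (as are the components of
  the maps below), so that HOL equality is equality of set-theoretic maps.
\<close>

definition weak_hdts :: "('s, 'a, 'l) whdts \<Rightarrow> bool" where
  "weak_hdts X \<longleftrightarrow>
     label X \<in> actions X \<rightarrow>\<^sub>E UNIV \<and>
     (\<forall>(\<alpha>, us, \<beta>) \<in> transitions X.
        \<alpha> \<in> states X \<and> \<beta> \<in> states X \<and> us \<noteq> [] \<and> set us \<subseteq> actions X) \<and>
     (\<forall>\<alpha> us \<beta> \<sigma>.
        (\<alpha>, us, \<beta>) \<in> transitions X \<longrightarrow> length us \<ge> 2 \<longrightarrow> \<sigma> permutes {..<length us} \<longrightarrow>
        (\<alpha>, permute_list \<sigma> us, \<beta>) \<in> transitions X) \<and>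
     (\<forall>\<alpha> \<beta> \<nu>\<^sub>1 \<nu>\<^sub>2 us vs ws.
        us \<noteq> [] \<longrightarrow> vs \<noteq> [] \<longrightarrow> ws \<noteq> [] \<longrightarrow>
        (\<alpha>, us @ vs @ ws, \<beta>) \<in> transitions X \<longrightarrow>
        (\<alpha>, us, \<nu>\<^sub>1) \<in> transitions X \<longrightarrow>
        (\<nu>\<^sub>1, vs @ ws, \<beta>) \<in> transitions X \<longrightarrow>
        (\<alpha>, us @ vs, \<nu>\<^sub>2) \<in> transitions X \<longrightarrow>
        (\<nu>\<^sub>2, ws, \<beta>) \<in> transitions X \<longrightarrow>
        (\<nu>\<^sub>1, vs, \<nu>\<^sub>2) \<in> transitions X)"

type_synonym ('s, 'a, 't, 'b) map_pair = "('s \<Rightarrow> 't) \<times> ('a \<Rightarrow> 'b)"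

definition whdts_map ::
  "('s, 'a, 'l) whdts \<Rightarrow> ('t, 'b, 'l) whdts \<Rightarrow> ('s, 'a, 't, 'b) map_pair \<Rightarrow> bool" where
  "whdts_map X Y f \<longleftrightarrow>
     fst f \<in> states X \<rightarrow>\<^sub>E states Y \<and>
     snd f \<in> actions X \<rightarrow>\<^sub>E actions Y \<and>
     (\<forall>u \<in> actions X. label Y (snd f u) = label X u) \<and>
     (\<forall>(\<alpha>, us, \<beta>) \<in> transitions X. (fst f \<alpha>, map (snd f) us, fst f \<beta>) \<in> transitions Y)"

definition id_map :: "('s, 'a, 'l) whdts \<Rightarrow> ('s, 'a, 's, 'a) map_pair" where
  "id_map X = (restrict id (states X), restrict id (actions X))"

text \<open>\<open>comp_map X g f\<close> is the composite of \<open>f\<close>, whose domain is \<open>X\<close>, followed by \<open>g\<close>.\<close>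

definition comp_map ::
  "('s, 'a, 'l) whdts \<Rightarrow> ('t, 'b, 'r, 'c) map_pair \<Rightarrow> ('s, 'a, 't, 'b) map_pair \<Rightarrow>
   ('s, 'a, 'r, 'c) map_pair" where
  "comp_map X g f =
     (compose (states X) (fst g) (fst f), compose (actions X) (snd g) (snd f))"

definition isomorphic :: "('s, 'a, 'l) whdts \<Rightarrow> ('t, 'b, 'l) whdts \<Rightarrow> bool" where
  "isomorphic X Y \<longleftrightarrow>
     (\<exists>f g. whdts_map X Y f \<and> whdts_map Y X g \<and>
            comp_map X g f = id_map X \<and> comp_map Y f g = id_map Y)"

text \<open>The \<open>n\<close>-cube; the coordinates are numbered \<open>0, \<dots>, n - 1\<close> instead of \<open>1, \<dots>, n\<close>.\<close>

definition cube :: "'l list \<Rightarrow> (bool list, 'l \<times> nat, 'l) whdts" where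
  "cube xs = \<lparr>
     states = {\<epsilon>. length \<epsilon> = length xs},
     actions = {(xs ! i, i) | i. i < length xs},
     label = restrict fst {(xs ! i, i) | i. i < length xs},
     transitions =
       {(\<epsilon>, map (\<lambda>i. (xs ! i, i)) js, \<epsilon>') | \<epsilon> js \<epsilon>'.
          length \<epsilon> = length xs \<and> length \<epsilon>' = length xs \<and>
          js \<noteq> [] \<and> distinct js \<and> set js \<subseteq> {..<length xs} \<and>
          (\<forall>i < length xs. \<epsilon> ! i \<le> \<epsilon>' ! i) \<and>
          (\<forall>i < length xs. \<epsilon> ! i \<noteq> \<epsilon>' ! i \<longleftrightarrow> i \<in> set js)}\<rparr>"

definition double_transition :: "'l \<Rightarrow> (nat, 'l, 'l) whdts" where
  "double_transition x = \<lparr>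
     states = {1, 2, 3, 4},
     actions = {x},
     label = restrict id {x},
     transitions = {(1, [x], 2), (3, [x], 4)}\<rparr>"


section \<open>Cubical transition systems\<close>

text \<open>
  The monomorphisms of weak HDTS are the maps that are injective on states and on actions. Hence
  every subobject of \<open>X\<close> has exactly one representative whose sets of states, actions and transitions
  are subsets of those of \<open>X\<close> (it need not contain all transitions of \<open>X\<close> between its states), and
  \<open>subobject\<close> is also the order of the poset of subobjects.
\<close>

definition subobject :: "('s, 'a, 'l) whdts \<Rightarrow> ('s, 'a, 'l) whdts \<Rightarrow> bool" where
  "subobject A X \<longleftrightarrow>
     weak_hdts A \<and> states A \<subseteq> states X \<and> actions A \<subseteq> actions X \<and>
     label A = restrict (label X) (actions A) \<and> transitions A \<subseteq> transitions X"

definition is_image ::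
  "('t, 'b, 'l) whdts \<Rightarrow> ('s, 'a, 'l) whdts \<Rightarrow> ('t, 'b, 's, 'a) map_pair \<Rightarrow>
   ('s, 'a, 'l) whdts \<Rightarrow> bool" where
  "is_image C X f A \<longleftrightarrow>
     subobject A X \<and> whdts_map C A f \<and>
     (\<forall>B. subobject B X \<and> whdts_map C B f \<longrightarrow> subobject A B)"

definition subcube :: "('s, 'a, 'l) whdts \<Rightarrow> ('s, 'a, 'l) whdts \<Rightarrow> bool" where
  "subcube A X \<longleftrightarrow> (\<exists>xs f. whdts_map (cube xs) X f \<and> is_image (cube xs) X f A)"

definition is_union ::
  "('s, 'a, 'l) whdts \<Rightarrow> ('s, 'a, 'l) whdts set \<Rightarrow> ('s, 'a, 'l) whdts \<Rightarrow> bool" where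
  "is_union X \<A> U \<longleftrightarrow>
     subobject U X \<and> (\<forall>A \<in> \<A>. subobject A U) \<and>
     (\<forall>B. subobject B X \<and> (\<forall>A \<in> \<A>. subobject A B) \<longrightarrow> subobject U B)"

definition cubical :: "('s, 'a, 'l) whdts \<Rightarrow> bool" where
  "cubical X \<longleftrightarrow> weak_hdts X \<and> is_union X {A. subcube A X} X"

lemma weak_hdtsD:
  assumes "weak_hdts X"
  shows "label X \<in> actions X \<rightarrow>\<^sub>E UNIV"
    and "(\<alpha>, us, \<beta>) \<in> transitions X \<Longrightarrow>
           \<alpha> \<in> states X \<and> \<beta> \<in> states X \<and> us \<noteq> [] \<and> set us \<subseteq> actions X"
    and "(\<alpha>, us, \<beta>) \<in> transitions X \<Longrightarrow> length us \<ge> 2 \<Longrightarrow> \<sigma> permutes {..<length us} \<Longrightarrow>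
           (\<alpha>, permute_list \<sigma> us, \<beta>) \<in> transitions X"
    and "us \<noteq> [] \<Longrightarrow> vs \<noteq> [] \<Longrightarrow> ws \<noteq> [] \<Longrightarrow>
           (\<alpha>, us @ vs @ ws, \<beta>) \<in> transitions X \<Longrightarrow>
           (\<alpha>, us, \<nu>\<^sub>1) \<in> transitions X \<Longrightarrow> (\<nu>\<^sub>1, vs @ ws, \<beta>) \<in> transitions X \<Longrightarrow>
           (\<alpha>, us @ vs, \<nu>\<^sub>2) \<in> transitions X \<Longrightarrow> (\<nu>\<^sub>2, ws, \<beta>) \<in> transitions X \<Longrightarrow>
           (\<nu>\<^sub>1, vs, \<nu>\<^sub>2) \<in> transitions X"
proof -
  note * = assms[unfolded weak_hdts_def]
  show "label X \<in> actions X \<rightarrow>\<^sub>E UNIV"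
    using * by (rule conjunct1)
  show "(\<alpha>, us, \<beta>) \<in> transitions X \<Longrightarrow>
           \<alpha> \<in> states X \<and> \<beta> \<in> states X \<and> us \<noteq> [] \<and> set us \<subseteq> actions X"
    by (drule *[THEN conjunct2, THEN conjunct1, THEN bspec]) simp
  show "(\<alpha>, us, \<beta>) \<in> transitions X \<Longrightarrow> length us \<ge> 2 \<Longrightarrow> \<sigma> permutes {..<length us} \<Longrightarrow>
           (\<alpha>, permute_list \<sigma> us, \<beta>) \<in> transitions X"
    by (rule *[THEN conjunct2, THEN conjunct2, THEN conjunct1, rule_format])
  show "us \<noteq> [] \<Longrightarrow> vs \<noteq> [] \<Longrightarrow> ws \<noteq> [] \<Longrightarrow>
           (\<alpha>, us @ vs @ ws, \<beta>) \<in> transitions X \<Longrightarrow>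
           (\<alpha>, us, \<nu>\<^sub>1) \<in> transitions X \<Longrightarrow> (\<nu>\<^sub>1, vs @ ws, \<beta>) \<in> transitions X \<Longrightarrow>
           (\<alpha>, us @ vs, \<nu>\<^sub>2) \<in> transitions X \<Longrightarrow> (\<nu>\<^sub>2, ws, \<beta>) \<in> transitions X \<Longrightarrow>
           (\<nu>\<^sub>1, vs, \<nu>\<^sub>2) \<in> transitions X"
    by (rule *[THEN conjunct2, THEN conjunct2, THEN conjunct2, rule_format])
qed

lemma whdts_mapD:
  assumes "whdts_map X Y f"
  shows "fst f \<in> states X \<rightarrow>\<^sub>E states Y"
    and "snd f \<in> actions X \<rightarrow>\<^sub>E actions Y"
    and "u \<in> actions X \<Longrightarrow> label Y (snd f u) = label X u"
    and "(\<alpha>, us, \<beta>) \<in> transitions X \<Longrightarrow> (fst f \<alpha>, map (snd f) us, fst f \<beta>) \<in> transitions Y"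
proof -
  note * = assms[unfolded whdts_map_def]
  show "fst f \<in> states X \<rightarrow>\<^sub>E states Y" "snd f \<in> actions X \<rightarrow>\<^sub>E actions Y"
    using * by simp_all
  show "u \<in> actions X \<Longrightarrow> label Y (snd f u) = label X u"
    by (rule *[THEN conjunct2, THEN conjunct2, THEN conjunct1, THEN bspec])
  show "(\<alpha>, us, \<beta>) \<in> transitions X \<Longrightarrow> (fst f \<alpha>, map (snd f) us, fst f \<beta>) \<in> transitions Y"
    by (drule *[THEN conjunct2, THEN conjunct2, THEN conjunct2, THEN bspec]) simp
qed

lemma subobject_refl: "weak_hdts X \<Longrightarrow> subobject X X"
  using weak_hdtsD(1)[of X] by (simp add: subobject_def PiE_restrict)

lemma is_image_exists:
  assumes "weak_hdts X" "whdts_map C X f"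
  shows "\<exists>A. is_image C X f A"
proof -
  define P where "P B \<longleftrightarrow> subobject B X \<and> whdts_map C B f" for B
  define A where "A = \<lparr>
     states = {s \<in> states X. \<forall>B. P B \<longrightarrow> s \<in> states B},
     actions = {u \<in> actions X. \<forall>B. P B \<longrightarrow> u \<in> actions B},
     label = restrict (label X) {u \<in> actions X. \<forall>B. P B \<longrightarrow> u \<in> actions B},
     transitions = {t \<in> transitions X. \<forall>B. P B \<longrightarrow> t \<in> transitions B}\<rparr>"
  have PX: "P X"
    using assms subobject_refl unfolding P_def by blast
  have PB: "weak_hdts B" "states B \<subseteq> states X" "actions B \<subseteq> actions X"
    "label B = restrict (label X) (actions B)" "transitions B \<subseteq> transitions X"
    "whdts_map C B f" if "P B" for B
    using that unfolding P_def subobject_def by blast+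
  have st: "s \<in> states A \<longleftrightarrow> (\<forall>B. P B \<longrightarrow> s \<in> states B)"
    and ac: "u \<in> actions A \<longleftrightarrow> (\<forall>B. P B \<longrightarrow> u \<in> actions B)"
    and tr: "t \<in> transitions A \<longleftrightarrow> (\<forall>B. P B \<longrightarrow> t \<in> transitions B)" for s u t
    using PX by (simp_all add: A_def) blast+
  have lab: "label A = restrict (label X) (actions A)"
    by (simp add: A_def)
  have wA: "weak_hdts A"
    unfolding weak_hdts_def
  proof (intro conjI)
    show "label A \<in> actions A \<rightarrow>\<^sub>E UNIV"
      by (simp add: lab)
    show "\<forall>(\<alpha>, us, \<beta>) \<in> transitions A.
        \<alpha> \<in> states A \<and> \<beta> \<in> states A \<and> us \<noteq> [] \<and> set us \<subseteq> actions A"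
    proof clarify
      fix \<alpha> us \<beta>
      assume t: "(\<alpha>, us, \<beta>) \<in> transitions A"
      have *: "\<alpha> \<in> states B \<and> \<beta> \<in> states B \<and> us \<noteq> [] \<and> set us \<subseteq> actions B" if "P B" for B
        using t that by (intro weak_hdtsD(2) PB(1)) (simp_all add: tr)
      show "\<alpha> \<in> states A \<and> \<beta> \<in> states A \<and> us \<noteq> [] \<and> set us \<subseteq> actions A"
        using *[OF PX] * unfolding st ac subset_iff by blast
    qed
    show "\<forall>\<alpha> us \<beta> \<sigma>.
        (\<alpha>, us, \<beta>) \<in> transitions A \<longrightarrow> length us \<ge> 2 \<longrightarrow> \<sigma> permutes {..<length us} \<longrightarrow>
        (\<alpha>, permute_list \<sigma> us, \<beta>) \<in> transitions A"
      unfolding tr by (intro allI impI weak_hdtsD(3) PB(1)) simp_all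
    show "\<forall>\<alpha> \<beta> \<nu>\<^sub>1 \<nu>\<^sub>2 us vs ws.
        us \<noteq> [] \<longrightarrow> vs \<noteq> [] \<longrightarrow> ws \<noteq> [] \<longrightarrow>
        (\<alpha>, us @ vs @ ws, \<beta>) \<in> transitions A \<longrightarrow>
        (\<alpha>, us, \<nu>\<^sub>1) \<in> transitions A \<longrightarrow>
        (\<nu>\<^sub>1, vs @ ws, \<beta>) \<in> transitions A \<longrightarrow>
        (\<alpha>, us @ vs, \<nu>\<^sub>2) \<in> transitions A \<longrightarrow>
        (\<nu>\<^sub>2, ws, \<beta>) \<in> transitions A \<longrightarrow>
        (\<nu>\<^sub>1, vs, \<nu>\<^sub>2) \<in> transitions A"
    proof (intro allI impI)
      fix \<alpha> \<beta> \<nu>\<^sub>1 \<nu>\<^sub>2 us vs ws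
      assume ne: "us \<noteq> []" "vs \<noteq> []" "ws \<noteq> []"
        and t: "(\<alpha>, us @ vs @ ws, \<beta>) \<in> transitions A" "(\<alpha>, us, \<nu>\<^sub>1) \<in> transitions A"
          "(\<nu>\<^sub>1, vs @ ws, \<beta>) \<in> transitions A" "(\<alpha>, us @ vs, \<nu>\<^sub>2) \<in> transitions A"
          "(\<nu>\<^sub>2, ws, \<beta>) \<in> transitions A"
      show "(\<nu>\<^sub>1, vs, \<nu>\<^sub>2) \<in> transitions A"
        unfolding tr
      proof (intro allI impI)
        fix B assume "P B"
        then have B: "weak_hdts B" "(\<alpha>, us @ vs @ ws, \<beta>) \<in> transitions B"
          "(\<alpha>, us, \<nu>\<^sub>1) \<in> transitions B" "(\<nu>\<^sub>1, vs @ ws, \<beta>) \<in> transitions B"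
          "(\<alpha>, us @ vs, \<nu>\<^sub>2) \<in> transitions B" "(\<nu>\<^sub>2, ws, \<beta>) \<in> transitions B"
          using PB(1) t[unfolded tr] by blast+
        show "(\<nu>\<^sub>1, vs, \<nu>\<^sub>2) \<in> transitions B"
          by (rule weak_hdtsD(4)[OF B(1) ne B(2-)])
      qed
    qed
  qed
  have AX: "subobject A X"
  proof -
    have "states A \<subseteq> states X" "actions A \<subseteq> actions X" "transitions A \<subseteq> transitions X"
      unfolding A_def by auto
    then show ?thesis
      using wA lab by (simp add: subobject_def)
  qed
  have "whdts_map C A f"
    unfolding whdts_map_def
  proof (intro conjI)
    show "fst f \<in> states C \<rightarrow>\<^sub>E states A"
    proof (rule PiE_I)
      show "fst f s \<in> states A" if "s \<in> states C" for s
        unfolding st using whdts_mapD(1)[OF PB(6)] that by (blast dest: PiE_mem)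
      show "fst f s = undefined" if "s \<notin> states C" for s
        using whdts_mapD(1)[OF assms(2)] that by (rule PiE_arb)
    qed
    show acf: "snd f \<in> actions C \<rightarrow>\<^sub>E actions A"
    proof (rule PiE_I)
      show "snd f u \<in> actions A" if "u \<in> actions C" for u
        unfolding ac using whdts_mapD(2)[OF PB(6)] that by (blast dest: PiE_mem)
      show "snd f u = undefined" if "u \<notin> actions C" for u
        using whdts_mapD(2)[OF assms(2)] that by (rule PiE_arb)
    qed
    show "\<forall>u \<in> actions C. label A (snd f u) = label C u"
      using PiE_mem[OF acf] whdts_mapD(3)[OF assms(2)] by (simp add: lab)
    show "\<forall>(\<alpha>, us, \<beta>) \<in> transitions C. (fst f \<alpha>, map (snd f) us, fst f \<beta>) \<in> transitions A"
      using whdts_mapD(4)[OF PB(6)] by (auto simp: tr)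
  qed
  moreover have "subobject A B" if "P B" for B
  proof -
    have sub: "states A \<subseteq> states B" "actions A \<subseteq> actions B" "transitions A \<subseteq> transitions B"
      unfolding subset_iff st ac tr using that by blast+
    then have "restrict (label B) (actions A) = label A"
      unfolding PB(4)[OF that] lab by (simp add: Int_absorb1)
    then show ?thesis
      using wA sub unfolding subobject_def by simp
  qed
  ultimately show ?thesis
    using AX unfolding is_image_def P_def by blast
qed

lemma cubical_double_transition: "cubical (double_transition x)"
proof -
  let ?X = "double_transition x"
  have w: "weak_hdts ?X"
    unfolding weak_hdts_def
    by (auto simp: double_transition_def append_eq_Cons_conv)
  have *: "s \<in> states B \<and> t \<in> states B \<and> x \<in> actions B \<and> (s, [x], t) \<in> transitions B"
    if st: "(s, [x], t) \<in> transitions ?X" and B: "subobject B ?X" "\<And>A. subcube A ?X \<Longrightarrow> subobject A B"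
    for s t B
  proof -
    have st': "s = 1 \<and> t = 2 \<or> s = 3 \<and> t = 4"
      using st by (auto simp: double_transition_def)
    define f where "f = (restrict (\<lambda>\<epsilon>. if hd \<epsilon> then t else s) (states (cube [x])),
      restrict fst (actions (cube [x])))"
    have js: "js = [0]" if "set js \<subseteq> {0}" "js \<noteq> []" "distinct js" for js :: "nat list"
      using that by (cases js rule: remdups_adj.cases) auto
    have cube1: "states (cube [x]) = {[False], [True]}" "actions (cube [x]) = {(x, 0)}"
      "label (cube [x]) = restrict fst {(x, 0)}"
      "transitions (cube [x]) = {([False], [(x, 0)], [True])}"
    proof -
      show "states (cube [x]) = {[False], [True]}"
        by (auto simp: cube_def length_Suc_conv)
      show "actions (cube [x]) = {(x, 0)}" "label (cube [x]) = restrict fst {(x, 0)}"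
        by (auto simp: cube_def)
      show "transitions (cube [x]) = {([False], [(x, 0)], [True])}"
        by (auto simp: cube_def length_Suc_conv lessThan_Suc dest!: js intro!: exI[of _ "[0]"])
    qed
    have f: "whdts_map (cube [x]) ?X f"
      using st' by (auto simp: whdts_map_def f_def cube1 double_transition_def)
    obtain A where A: "is_image (cube [x]) ?X f A"
      using is_image_exists[OF w f] by blast
    have AB: "subobject A B"
      using A f by (intro B(2)) (unfold subcube_def, blast)
    have fA: "whdts_map (cube [x]) A f" and wA: "weak_hdts A"
      using A by (simp_all add: is_image_def subobject_def)
    have "(s, [x], t) \<in> transitions A"
      using whdts_mapD(4)[OF fA, of "[False]" "[(x, 0)]" "[True]"] by (simp add: f_def cube1)
    then show ?thesis
      using weak_hdtsD(2)[OF wA] AB unfolding subobject_def by force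
  qed
  have "subobject ?X B" if B: "subobject B ?X" "\<And>A. subcube A ?X \<Longrightarrow> subobject A B" for B
  proof -
    have t: "transitions ?X \<subseteq> transitions B" "states ?X \<subseteq> states B" "actions ?X \<subseteq> actions B"
      using *[OF _ B, of 1 2] *[OF _ B, of 3 4] by (simp_all add: double_transition_def)
    then have "actions B = actions ?X"
      using B(1) by (auto simp: subobject_def)
    then show ?thesis
      using t B(1) w by (simp add: subobject_def double_transition_def)
  qed
  then show ?thesis
    using w subobject_refl[OF w]
    unfolding cubical_def is_union_def subcube_def is_image_def mem_Collect_eq by blast
qed

text \<open>
  The type \<open>'u\<close> plays the role of a universe: a set is small if it has fewer elements than \<open>'u\<close>, and
  the objects of the category are those whose sets of states and actions are small subsets of \<open>'u\<close>.
  If the cardinality of \<open>'u\<close> is inaccessible, this is, up to equivalence, the category of cubical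
  transition systems in a Grothendieck universe.
\<close>

definition CTS :: "('u, 'u, 'l) whdts set" where
  "CTS = {X. cubical X \<and> states X \<prec> (UNIV :: 'u set) \<and> actions X \<prec> (UNIV :: 'u set)}"

type_synonym ('u, 'l) arrow =
  "('u, 'u, 'l) whdts \<times> ('u, 'u, 'u, 'u) map_pair \<times> ('u, 'u, 'l) whdts"

definition CTS_arrows :: "('u, 'l) arrow set" where
  "CTS_arrows = {(X, f, Y). X \<in> CTS \<and> Y \<in> CTS \<and> whdts_map X Y f}"

definition cofibrations :: "('u, 'l) arrow set" where
  "cofibrations = {(X, f, Y) \<in> CTS_arrows. inj_on (snd f) (actions X)}"


section \<open>Colimits and cubification\<close>

text \<open>
  A diagram is given by a family \<open>D\<close> of weak HDTS indexed by a set \<open>I\<close> and a set \<open>E\<close> of triples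
  \<open>(i, f, j)\<close> with \<open>f\<close> a map from \<open>D i\<close> to \<open>D j\<close>. Its objects need not lie in the universe \<open>'u\<close>,
  but colimits are taken in the category of cubical transition systems in \<open>'u\<close>.
\<close>

definition is_cocone ::
  "'i set \<Rightarrow> ('i \<Rightarrow> ('s, 'a, 'l) whdts) \<Rightarrow> ('i \<times> ('s, 'a, 's, 'a) map_pair \<times> 'i) set \<Rightarrow>
   ('u, 'u, 'l) whdts \<Rightarrow> ('i \<Rightarrow> ('s, 'a, 'u, 'u) map_pair) \<Rightarrow> bool" where
  "is_cocone I D E C \<iota> \<longleftrightarrow>
     (\<forall>i \<in> I. whdts_map (D i) C (\<iota> i)) \<and>
     (\<forall>(i, f, j) \<in> E. comp_map (D i) (\<iota> j) f = \<iota> i)"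

definition is_colimit ::
  "'i set \<Rightarrow> ('i \<Rightarrow> ('s, 'a, 'l) whdts) \<Rightarrow> ('i \<times> ('s, 'a, 's, 'a) map_pair \<times> 'i) set \<Rightarrow>
   ('u, 'u, 'l) whdts \<Rightarrow> ('i \<Rightarrow> ('s, 'a, 'u, 'u) map_pair) \<Rightarrow> bool" where
  "is_colimit I D E C \<iota> \<longleftrightarrow>
     C \<in> CTS \<and> is_cocone I D E C \<iota> \<and>
     (\<forall>C' \<in> CTS :: ('u, 'u, 'l) whdts set. \<forall>\<iota>'. is_cocone I D E C' \<iota>' \<longrightarrow>
        (\<exists>!h. whdts_map C C' h \<and> (\<forall>i \<in> I. comp_map (D i) h (\<iota> i) = \<iota>' i)))"

type_synonym ('s, 'a, 'l) cube_over = "'l list \<times> (bool list, 'l \<times> nat, 's, 'a) map_pair"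

definition cubes_over :: "('s, 'a, 'l) whdts \<Rightarrow> ('s, 'a, 'l) cube_over set" where
  "cubes_over X = {(xs, c). whdts_map (cube xs) X c}"

definition cubes_over_maps ::
  "('s, 'a, 'l) whdts \<Rightarrow>
   (('s, 'a, 'l) cube_over \<times> (bool list, 'l \<times> nat, bool list, 'l \<times> nat) map_pair \<times>
    ('s, 'a, 'l) cube_over) set" where
  "cubes_over_maps X =
     {((ys, d), \<phi>, (xs, c)) | ys d \<phi> xs c.
        whdts_map (cube ys) X d \<and> whdts_map (cube xs) X c \<and>
        whdts_map (cube ys) (cube xs) \<phi> \<and> comp_map (cube ys) c \<phi> = d}"

definition is_cubification ::
  "('u, 'u, 'l) whdts \<Rightarrow> ('u, 'u, 'l) whdts \<Rightarrow>
   (('u, 'u, 'l) cube_over \<Rightarrow> (bool list, 'l \<times> nat, 'u, 'u) map_pair) \<Rightarrow> bool" where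
  "is_cubification X C \<iota> \<longleftrightarrow>
     is_colimit (cubes_over X) (\<lambda>(xs, c). cube xs) (cubes_over_maps X) C \<iota>"

definition is_counit ::
  "('u, 'u, 'l) whdts \<Rightarrow> ('u, 'u, 'l) whdts \<Rightarrow>
   (('u, 'u, 'l) cube_over \<Rightarrow> (bool list, 'l \<times> nat, 'u, 'u) map_pair) \<Rightarrow>
   ('u, 'u, 'u, 'u) map_pair \<Rightarrow> bool" where
  "is_counit X C \<iota> p \<longleftrightarrow>
     whdts_map C X p \<and>
     (\<forall>(xs, c) \<in> cubes_over X. comp_map (cube xs) p (\<iota> (xs, c)) = c)"


section \<open>Localizers\<close>

definition has_rlp :: "('u, 'l) arrow set \<Rightarrow> ('u, 'l) arrow \<Rightarrow> bool" where
  "has_rlp \<A> = (\<lambda>(X, p, Y).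
     \<forall>(P, i, Q) \<in> \<A>. \<forall>a b.
       whdts_map P X a \<and> whdts_map Q Y b \<and> comp_map P p a = comp_map P b i \<longrightarrow>
       (\<exists>l. whdts_map Q X l \<and> comp_map P l i = a \<and> comp_map Q p l = b))"

definition two_out_of_three :: "('u, 'l) arrow set \<Rightarrow> bool" where
  "two_out_of_three \<W> \<longleftrightarrow>
     (\<forall>X Y Z f g. (X, f, Y) \<in> CTS_arrows \<longrightarrow> (Y, g, Z) \<in> CTS_arrows \<longrightarrow>
        ((X, f, Y) \<in> \<W> \<and> (Y, g, Z) \<in> \<W> \<longrightarrow> (X, comp_map X g f, Z) \<in> \<W>) \<and>
        ((X, f, Y) \<in> \<W> \<and> (X, comp_map X g f, Z) \<in> \<W> \<longrightarrow> (Y, g, Z) \<in> \<W>) \<and>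
        ((Y, g, Z) \<in> \<W> \<and> (X, comp_map X g f, Z) \<in> \<W> \<longrightarrow> (X, f, Y) \<in> \<W>))"

text \<open>
  \<open>is_pushout X f Y g Z h k P\<close>: the maps \<open>h : Y \<rightarrow> P\<close> and \<open>k : Z \<rightarrow> P\<close> are a pushout of
  \<open>f : X \<rightarrow> Y\<close> and \<open>g : X \<rightarrow> Z\<close>.
\<close>

definition is_pushout where
  "is_pushout X f Y g Z h k P \<longleftrightarrow>
     (X, f, Y) \<in> CTS_arrows \<and> (X, g, Z) \<in> CTS_arrows \<and>
     (Y, h, P) \<in> CTS_arrows \<and> (Z, k, P) \<in> CTS_arrows \<and>
     comp_map X h f = comp_map X k g \<and>
     (\<forall>Q h' k'. (Y, h', Q) \<in> CTS_arrows \<and> (Z, k', Q) \<in> CTS_arrows \<and>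
        comp_map X h' f = comp_map X k' g \<longrightarrow>
        (\<exists>!l. whdts_map P Q l \<and> comp_map Y l h = h' \<and> comp_map Z l k = k'))"

definition closed_under_pushout :: "('u, 'l) arrow set \<Rightarrow> bool" where
  "closed_under_pushout \<K> \<longleftrightarrow>
     (\<forall>X f Y g Z h k P. (X, f, Y) \<in> \<K> \<longrightarrow> is_pushout X f Y g Z h k P \<longrightarrow> (Z, k, P) \<in> \<K>)"

text \<open>
  The full subdiagram on \<open>J\<close> of a diagram \<open>(D, \<phi>)\<close> indexed by the well-order \<open>r\<close>, where
  \<open>\<phi> i j\<close> is the map from \<open>D i\<close> to \<open>D j\<close> for \<open>(i, j) \<in> r\<close>.
\<close>

definition chain_maps ::
  "'i rel \<Rightarrow> ('i \<Rightarrow> 'i \<Rightarrow> ('u, 'u, 'u, 'u) map_pair) \<Rightarrow> 'i set \<Rightarrow>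
   ('i \<times> ('u, 'u, 'u, 'u) map_pair \<times> 'i) set" where
  "chain_maps r \<phi> J = {(i, \<phi> i j, j) | i j. i \<in> J \<and> j \<in> J \<and> (i, j) \<in> r}"

definition is_limit_elem :: "'i rel \<Rightarrow> 'i \<Rightarrow> bool" where
  "is_limit_elem r j \<longleftrightarrow>
     j \<in> Field r \<and> underS r j \<noteq> {} \<and> (\<forall>i \<in> underS r j. \<exists>k \<in> underS r j. i \<in> underS r k)"

definition is_succ_pair :: "'i rel \<Rightarrow> 'i \<Rightarrow> 'i \<Rightarrow> bool" where
  "is_succ_pair r i j \<longleftrightarrow> i \<in> underS r j \<and> (\<forall>k \<in> underS r j. (k, i) \<in> r)"

text \<open>
  Ordinals are represented by the well-orders of small subsets of \<open>'u\<close>. A sequence indexed by a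
  nonzero ordinal is a colimit-preserving functor from it to the category.
\<close>

definition is_lambda_sequence ::
  "'u rel \<Rightarrow> ('u \<Rightarrow> ('u, 'u, 'l) whdts) \<Rightarrow> ('u \<Rightarrow> 'u \<Rightarrow> ('u, 'u, 'u, 'u) map_pair) \<Rightarrow> bool" where
  "is_lambda_sequence r D \<phi> \<longleftrightarrow>
     Well_order r \<and> Field r \<noteq> {} \<and> Field r \<prec> (UNIV :: 'u set) \<and>
     (\<forall>(i, j) \<in> r. (D i, \<phi> i j, D j) \<in> CTS_arrows) \<and>
     (\<forall>i \<in> Field r. \<phi> i i = id_map (D i)) \<and>
     (\<forall>i j k. (i, j) \<in> r \<longrightarrow> (j, k) \<in> r \<longrightarrow> comp_map (D i) (\<phi> j k) (\<phi> i j) = \<phi> i k) \<and>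
     (\<forall>j. is_limit_elem r j \<longrightarrow>
        is_colimit (underS r j) D (chain_maps r \<phi> (underS r j)) (D j) (\<lambda>i. \<phi> i j))"

definition closed_under_transfinite_composition :: "('u, 'l) arrow set \<Rightarrow> bool" where
  "closed_under_transfinite_composition \<K> \<longleftrightarrow>
     (\<forall>r D \<phi> C \<iota> i\<^sub>0.
        is_lambda_sequence r D \<phi> \<longrightarrow>
        (\<forall>i j. is_succ_pair r i j \<longrightarrow> (D i, \<phi> i j, D j) \<in> \<K>) \<longrightarrow>
        is_colimit (Field r) D (chain_maps r \<phi> (Field r)) C \<iota> \<longrightarrow>
        i\<^sub>0 \<in> Field r \<longrightarrow> underS r i\<^sub>0 = {} \<longrightarrow>
        (D i\<^sub>0, \<iota> i\<^sub>0, C) \<in> \<K>)"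

definition localizer :: "('u, 'l) arrow set \<Rightarrow> ('u, 'l) arrow set \<Rightarrow> bool" where
  "localizer \<A> \<W> \<longleftrightarrow>
     \<W> \<subseteq> CTS_arrows \<and>
     two_out_of_three \<W> \<and>
     (\<forall>w \<in> CTS_arrows. has_rlp \<A> w \<longrightarrow> w \<in> \<W>) \<and>
     closed_under_pushout (\<A> \<inter> \<W>) \<and>
     closed_under_transfinite_composition (\<A> \<inter> \<W>)"

definition smallest_localizer :: "('u, 'l) arrow set \<Rightarrow> ('u, 'l) arrow set" where
  "smallest_localizer \<A> = \<Inter> {\<W>. localizer \<A> \<W>}"

text \<open>
  A localizer with respect to \<open>\<A>\<close> exists only if pushouts and transfinite compositions of elements
  of \<open>\<A>\<close> are in \<open>\<A>\<close>, which holds for the cofibrations.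
\<close>

lemma localizer_smallest_localizer:
  assumes "localizer \<A> \<W>"
  shows "localizer \<A> (smallest_localizer \<A>)" and "smallest_localizer \<A> \<subseteq> \<W>"
proof -
  show sub: "smallest_localizer \<A> \<subseteq> \<W>"
    using assms by (auto simp: smallest_localizer_def)
  let ?S = "smallest_localizer \<A>"
  have mem: "w \<in> ?S \<longleftrightarrow> (\<forall>\<W>. localizer \<A> \<W> \<longrightarrow> w \<in> \<W>)" for w
    by (auto simp: smallest_localizer_def)
  have "?S \<subseteq> CTS_arrows"
    using sub assms by (auto simp: localizer_def)
  moreover have "two_out_of_three ?S"
  proof -
    have "two_out_of_three \<V>" if "localizer \<A> \<V>" for \<V>
      using that by (simp add: localizer_def)
    then show ?thesis
      unfolding two_out_of_three_def mem by blast
  qed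
  moreover have "w \<in> ?S" if "w \<in> CTS_arrows" "has_rlp \<A> w" for w
    using that by (auto simp: mem localizer_def)
  moreover have "closed_under_pushout (\<A> \<inter> ?S)"
  proof -
    have "closed_under_pushout (\<A> \<inter> \<V>)" if "localizer \<A> \<V>" for \<V>
      using that by (simp add: localizer_def)
    then show ?thesis
      using assms unfolding closed_under_pushout_def Int_iff mem by blast
  qed
  moreover have "closed_under_transfinite_composition (\<A> \<inter> ?S)"
  proof -
    have "closed_under_transfinite_composition (\<A> \<inter> \<V>)" if "localizer \<A> \<V>" for \<V>
      using that by (simp add: localizer_def)
    then show ?thesis
      using assms unfolding closed_under_transfinite_composition_def Int_iff mem by blast
  qed
  ultimately show "localizer \<A> ?S"
    by (simp add: localizer_def)
qed

text \<open>
  The left determined model structure is by definition the one with these cofibrations and with the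
  smallest localizer as class of weak equivalences.
\<close>

definition left_determined_weak_equivalences :: "('u, 'l) arrow set" where
  "left_determined_weak_equivalences = smallest_localizer cofibrations"

end

(*
  For every cubical Z in which two states determine the action between them, the maps that the
  functor Hom(-, Z) turns into bijections form a localizer: closure under 2-out-of-3 and colimits is
  formal, and a map f with the right lifting property against the cofibrations is a bijection on
  states and has a section l, where g o l o f and g agree for every g into Z because l o f is the
  identity on states. Taking for Z two loops with distinct actions labelled x, one per component of
  the double transition, gives a localizer that does not contain p_x: sending each copy of C_1[x] to
  its own loop does not factor through p_x, which identifies the two actions.
*)

theory Submission
  imports Defs
begin

section \<open>Maps and cubes\<close>

text \<open>Only the closure of the inverted maps is formal. A localizer asks for closure of their
  intersection with the cofibrations, so injectivity on actions must also pass to pushouts and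
  colimits of chains. A colimit is given by its universal property alone, so injectivity is detected
  by maps into one-state systems, where a map is no more than a label-preserving map of actions. The
  lifting argument treats states and actions differently. Cofibrations may identify states, so the
  restriction of \<open>f\<close> to states is itself a lifting test, which forces \<open>f\<close>
  to be injective on states. On actions, \<open>l o f\<close> can still exchange \<open>u\<close>
  for another action with the same label between the same states. The condition on \<open>Z\<close>
  hides this exchange, and it applies to every action because in a cubical system each action is
  carried by a transition of length one.\<close>

lemma comp_map_apply:
  "s \<in> states X \<Longrightarrow> fst (comp_map X g f) s = fst g (fst f s)"
  "u \<in> actions X \<Longrightarrow> snd (comp_map X g f) u = snd g (snd f u)"
  by (simp_all add: comp_map_def compose_eq)

lemma id_map_apply:
  "s \<in> states X \<Longrightarrow> fst (id_map X) s = s"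
  "u \<in> actions X \<Longrightarrow> snd (id_map X) u = u"
  by (simp_all add: id_map_def)

lemma whdts_map_mem:
  assumes "whdts_map X Y f"
  shows "s \<in> states X \<Longrightarrow> fst f s \<in> states Y" "u \<in> actions X \<Longrightarrow> snd f u \<in> actions Y"
  using whdts_mapD(1,2)[OF assms] by (auto dest: PiE_mem)

lemma whdts_mapI:
  assumes "fst f \<in> extensional (states X)" "snd f \<in> extensional (actions X)"
    and "\<And>s. s \<in> states X \<Longrightarrow> fst f s \<in> states Y"
    and "\<And>u. u \<in> actions X \<Longrightarrow> snd f u \<in> actions Y"
    and "\<And>u. u \<in> actions X \<Longrightarrow> label Y (snd f u) = label X u"
    and "\<And>\<alpha> us \<beta>. (\<alpha>, us, \<beta>) \<in> transitions X \<Longrightarrow>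
           (fst f \<alpha>, map (snd f) us, fst f \<beta>) \<in> transitions Y"
  shows "whdts_map X Y f"
  using assms unfolding whdts_map_def PiE_def by auto

lemma whdts_map_eqI:
  assumes "whdts_map X Y f" "whdts_map X Y g"
    and "\<And>s. s \<in> states X \<Longrightarrow> fst f s = fst g s"
    and "\<And>u. u \<in> actions X \<Longrightarrow> snd f u = snd g u"
  shows "f = g"
proof (rule prod_eqI)
  show "fst f = fst g"
    by (rule PiE_ext[OF whdts_mapD(1)[OF assms(1)] whdts_mapD(1)[OF assms(2)] assms(3)])
  show "snd f = snd g"
    by (rule PiE_ext[OF whdts_mapD(2)[OF assms(1)] whdts_mapD(2)[OF assms(2)] assms(4)])
qed

lemma whdts_map_comp:
  assumes X: "weak_hdts X" and f: "whdts_map X Y f" and g: "whdts_map Y Z g"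
  shows "whdts_map X Z (comp_map X g f)"
proof (rule whdts_mapI)
  fix \<alpha> us \<beta> assume t: "(\<alpha>, us, \<beta>) \<in> transitions X"
  have mem: "\<alpha> \<in> states X" "\<beta> \<in> states X" "set us \<subseteq> actions X"
    using weak_hdtsD(2)[OF X t] by blast+
  have "map (snd (comp_map X g f)) us = map (snd g) (map (snd f) us)"
    using mem(3) unfolding map_map by (intro map_cong refl) (auto simp: comp_map_apply)
  then show "(fst (comp_map X g f) \<alpha>, map (snd (comp_map X g f)) us, fst (comp_map X g f) \<beta>)
      \<in> transitions Z"
    using whdts_mapD(4)[OF g whdts_mapD(4)[OF f t]] mem(1,2)
    by (simp add: comp_map_apply del: map_map)
qed (use whdts_map_mem[OF f] whdts_map_mem[OF g] whdts_mapD(3)[OF f] whdts_mapD(3)[OF g] in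
  \<open>auto simp: comp_map_apply\<close>, auto simp: comp_map_def)

lemma whdts_map_id: "weak_hdts X \<Longrightarrow> whdts_map X X (id_map X)"
proof (rule whdts_mapI)
  fix \<alpha> us \<beta> assume X: "weak_hdts X" and t: "(\<alpha>, us, \<beta>) \<in> transitions X"
  then have mem: "\<alpha> \<in> states X" "\<beta> \<in> states X" "set us \<subseteq> actions X"
    using weak_hdtsD(2)[OF X] by blast+
  then have "map (snd (id_map X)) us = us"
    by (auto simp: id_map_apply subset_iff intro: map_idI)
  then show "(fst (id_map X) \<alpha>, map (snd (id_map X)) us, fst (id_map X) \<beta>) \<in> transitions X"
    using t mem by (simp add: id_map_apply)
qed (auto simp: id_map_def)

text \<open>The values of \<open>f\<close> lie in \<open>Y\<close>, where the inner composite is not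
  cut off to \<open>undefined\<close>.\<close>

lemma comp_map_assoc:
  assumes "whdts_map X Y f"
  shows "comp_map X (comp_map Y h g) f = comp_map X h (comp_map X g f)"
  using whdts_mapD(1,2)[OF assms] unfolding comp_map_def
  by (auto intro!: compose_assoc[symmetric] simp: PiE_def)

lemma comp_map_id:
  assumes "whdts_map X Y f"
  shows "comp_map X f (id_map X) = f" "comp_map X (id_map Y) f = f"
proof -
  have f: "fst f \<in> extensional (states X)" "snd f \<in> extensional (actions X)"
    using whdts_mapD(1,2)[OF assms] by (simp_all add: PiE_def)
  show "comp_map X f (id_map X) = f"
    using f by (intro prod_eqI)
      (auto simp: comp_map_def id_map_def compose_def fun_eq_iff extensional_def)
  show "comp_map X (id_map Y) f = f"
  proof (rule prod_eqI)
    show "fst (comp_map X (id_map Y) f) = fst f"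
      by (rule extensionalityI[OF _ f(1)])
        (simp_all add: comp_map_apply id_map_apply whdts_map_mem[OF assms], simp add: comp_map_def)
    show "snd (comp_map X (id_map Y) f) = snd f"
      by (rule extensionalityI[OF _ f(2)])
        (simp_all add: comp_map_apply id_map_apply whdts_map_mem[OF assms], simp add: comp_map_def)
  qed
qed

section \<open>Vertices and transitions of the cubes\<close>

lemma cube_sel:
  "states (cube xs) = {\<epsilon>. length \<epsilon> = length xs}"
  "actions (cube xs) = {(xs ! i, i) | i. i < length xs}"
  "i < length xs \<Longrightarrow> label (cube xs) (xs ! i, i) = xs ! i"
  by (auto simp: cube_def)

lemma cube_transition_iff:
  "(\<epsilon>, us, \<epsilon>') \<in> transitions (cube xs) \<longleftrightarrow>
     length \<epsilon> = length xs \<and> length \<epsilon>' = length xs \<and>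
     (\<exists>js. us = map (\<lambda>i. (xs ! i, i)) js \<and> js \<noteq> [] \<and> distinct js \<and> set js \<subseteq> {..<length xs} \<and>
        (\<forall>i < length xs. \<epsilon> ! i \<le> \<epsilon>' ! i) \<and>
        (\<forall>i < length xs. \<epsilon> ! i \<noteq> \<epsilon>' ! i \<longleftrightarrow> i \<in> set js))"
  by (auto simp: cube_def)

lemma cube_transitionE:
  assumes "(\<epsilon>, us, \<epsilon>') \<in> transitions (cube xs)"
  obtains js where "us = map (\<lambda>i. (xs ! i, i)) js" "js \<noteq> []" "set js \<subseteq> {..<length xs}"
    "\<epsilon> \<in> states (cube xs)" "\<epsilon>' \<in> states (cube xs)" "set us \<subseteq> actions (cube xs)"
  using assms that unfolding cube_transition_iff cube_sel by fastforce

abbreviation origin :: "'l list \<Rightarrow> bool list" where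
  "origin xs \<equiv> replicate (length xs) False"

text \<open>The coordinates at which \<open>\<epsilon>\<close> is \<open>True\<close> are the
  directions to perform. Reaching every other vertex in one transition is what later keeps a whole
  cube inside one component.\<close>

lemma cube_transition_from_origin:
  assumes "length \<epsilon> = length xs" "\<epsilon> \<noteq> origin xs"
  shows "\<exists>us. (origin xs, us, \<epsilon>) \<in> transitions (cube xs)"
proof -
  let ?js = "filter (\<lambda>i. \<epsilon> ! i) [0..<length xs]"
  obtain i where "i < length xs" "\<epsilon> ! i"
    using assms nth_equalityI[of \<epsilon> "origin xs"] by auto
  then have "?js \<noteq> []"
    by (auto simp: filter_empty_conv)
  then have "(origin xs, map (\<lambda>i. (xs ! i, i)) ?js, \<epsilon>) \<in> transitions (cube xs)"
    using assms(1) unfolding cube_transition_iff by (auto intro!: exI[of _ ?js])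
  then show ?thesis ..
qed

lemma cube_long_transition:
  assumes "xs \<noteq> []"
  shows "(origin xs, map (\<lambda>i. (xs ! i, i)) [0..<length xs], replicate (length xs) True)
    \<in> transitions (cube xs)"
  using assms unfolding cube_transition_iff by (auto intro!: exI[of _ "[0..<length xs]"])

lemma cube_action_step:
  assumes "i < length xs"
  shows "(origin xs, [(xs ! i, i)], (origin xs)[i := True]) \<in> transitions (cube xs)"
  unfolding cube_transition_iff
  by (intro conjI exI[of _ "[i]"]) (use assms in \<open>auto simp: nth_list_update\<close>)

lemma cube_singleton_transitions:
  "transitions (cube [x]) = {([False], [(x, 0)], [True])}"
proof -
  have "(\<epsilon>, us, \<epsilon>') = ([False], [(x, 0)], [True])"
    if t: "(\<epsilon>, us, \<epsilon>') \<in> transitions (cube [x])" for \<epsilon> us \<epsilon>'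
  proof -
    obtain js where js: "us = map (\<lambda>i. ([x] ! i, i)) js" "js \<noteq> []" "distinct js" "set js \<subseteq> {0}"
      and \<epsilon>: "length \<epsilon> = 1" "length \<epsilon>' = 1" "\<epsilon> ! 0 \<le> \<epsilon>' ! 0" "\<epsilon> ! 0 \<noteq> \<epsilon>' ! 0 \<longleftrightarrow> 0 \<in> set js"
      using t unfolding cube_transition_iff by (auto simp: lessThan_Suc)
    have "js = [0]"
      using js(2-4) by (cases js rule: remdups_adj.cases) auto
    moreover obtain e e' where "\<epsilon> = [e]" "\<epsilon>' = [e']"
      using \<epsilon>(1,2) by (auto simp: length_Suc_conv)
    ultimately show ?thesis
      using js(1) \<epsilon>(3,4) by auto
  qed
  then have "transitions (cube [x]) \<subseteq> {([False], [(x, 0)], [True])}"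
    unfolding subset_iff split_paired_All singleton_iff by blast
  moreover have "([False], [(x, 0)], [True]) \<in> transitions (cube [x])"
    using cube_long_transition[of "[x]"] by simp
  ultimately show ?thesis
    by blast
qed


section \<open>Cubical transition systems\<close>

text \<open>A subobject containing all subcubes receives each state from a cube of dimension 0 and
  each transition from \<open>cub\<close>. By \<open>act\<close> it then has all actions, since it
  contains the actions of its transitions.\<close>

lemma cubicalI:
  fixes X :: "('s, 'a, 'l) whdts"
  assumes X: "weak_hdts X"
    and act: "\<And>u. u \<in> actions X \<Longrightarrow> \<exists>\<alpha> us \<beta>. (\<alpha>, us, \<beta>) \<in> transitions X \<and> u \<in> set us"
    and cub: "\<And>\<alpha> us \<beta>. (\<alpha>, us, \<beta>) \<in> transitions X \<Longrightarrow>
      \<exists>xs c \<epsilon> vs \<epsilon>'. whdts_map (cube xs) X c \<and> (\<epsilon>, vs, \<epsilon>') \<in> transitions (cube xs) \<and>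
        \<alpha> = fst c \<epsilon> \<and> us = map (snd c) vs \<and> \<beta> = fst c \<epsilon>'"
  shows "cubical X"
proof -
  have "subobject X B"
    if B: "subobject B X" "\<And>A. subcube A X \<Longrightarrow> subobject A B" for B
  proof -
    have cube_B: "\<exists>A. whdts_map (cube xs) A c \<and> subobject A B"
      if "whdts_map (cube xs) X c" for xs c
    proof -
      obtain A where A: "is_image (cube xs) X c A"
        using is_image_exists[OF X \<open>whdts_map (cube xs) X c\<close>] by blast
      then have "subobject A B"
        using that by (intro B(2)) (unfold subcube_def, blast)
      then show ?thesis
        using A by (auto simp: is_image_def)
    qed
    have wB: "weak_hdts B"
      using B(1) by (simp add: subobject_def)
    have st: "states X \<subseteq> states B"
    proof
      fix s assume s: "s \<in> states X"
      \<comment> \<open>A cube of dimension 0 has no actions, so the only extensional action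
        component is constantly \<open>undefined\<close>.\<close>
      define c where "c = (restrict (\<lambda>_. s) {[] :: bool list}, (\<lambda>_. undefined) :: 'l \<times> nat \<Rightarrow> 'a)"
      have "whdts_map (cube []) X c"
        using s by (intro whdts_mapI) (auto simp: c_def cube_def)
      then obtain A where "whdts_map (cube []) A c" "subobject A B"
        using cube_B by blast
      then show "s \<in> states B"
        using whdts_map_mem(1)[of "cube []" A c "[]"] by (auto simp: subobject_def c_def cube_def)
    qed
    have tr: "transitions X \<subseteq> transitions B"
    proof clarify
      fix \<alpha> us \<beta> assume "(\<alpha>, us, \<beta>) \<in> transitions X"
      from cub[OF this] obtain xs c \<epsilon> vs \<epsilon>' where c: "whdts_map (cube xs) X c"
        "(\<epsilon>, vs, \<epsilon>') \<in> transitions (cube xs)" "\<alpha> = fst c \<epsilon>" "us = map (snd c) vs" "\<beta> = fst c \<epsilon>'"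
        by blast
      obtain A where "whdts_map (cube xs) A c" "subobject A B"
        using cube_B[OF c(1)] by blast
      then show "(\<alpha>, us, \<beta>) \<in> transitions B"
        using whdts_mapD(4)[of "cube xs" A c \<epsilon> vs \<epsilon>'] c by (auto simp: subobject_def)
    qed
    have ac: "actions X \<subseteq> actions B"
      using act tr weak_hdtsD(2)[OF wB] by (meson subset_iff)
    then have "actions X = actions B"
      using B(1) by (auto simp: subobject_def)
    then show ?thesis
      using st tr X B(1) weak_hdtsD(1)[OF X] by (simp add: subobject_def PiE_restrict)
  qed
  then show ?thesis
    using X subobject_refl[OF X]
    unfolding cubical_def is_union_def subcube_def is_image_def mem_Collect_eq by blast
qed

text \<open>The actions carried by transitions of length one span a subobject \<open>B\<close>.
  Every action of a cube is of this kind, so all cubes of \<open>X\<close> factor through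
  \<open>B\<close>, and \<open>X\<close>, being the union of its subcubes, is contained in
  \<open>B\<close>.\<close>

lemma cubical_action_step:
  assumes "cubical X" "u \<in> actions X"
  shows "\<exists>\<alpha> \<beta>. (\<alpha>, [u], \<beta>) \<in> transitions X"
proof -
  have X: "weak_hdts X" and un: "is_union X {A. subcube A X} X"
    using assms(1) by (simp_all add: cubical_def)
  define L where "L = {u \<in> actions X. \<exists>\<alpha> \<beta>. (\<alpha>, [u], \<beta>) \<in> transitions X}"
  define B where "B = \<lparr>states = states X, actions = L, label = restrict (label X) L,
    transitions = {(\<alpha>, us, \<beta>) \<in> transitions X. set us \<subseteq> L}\<rparr>"
  have wB: "weak_hdts B"
    unfolding weak_hdts_def
  proof (intro conjI)
    show "\<forall>(\<alpha>, us, \<beta>) \<in> transitions B.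
        \<alpha> \<in> states B \<and> \<beta> \<in> states B \<and> us \<noteq> [] \<and> set us \<subseteq> actions B"
      by (auto simp: B_def dest: weak_hdtsD(2)[OF X])
    show "\<forall>\<alpha> us \<beta> \<sigma>.
        (\<alpha>, us, \<beta>) \<in> transitions B \<longrightarrow> length us \<ge> 2 \<longrightarrow> \<sigma> permutes {..<length us} \<longrightarrow>
        (\<alpha>, permute_list \<sigma> us, \<beta>) \<in> transitions B"
      using weak_hdtsD(3)[OF X] by (auto simp: B_def)
    show "\<forall>\<alpha> \<beta> \<nu>\<^sub>1 \<nu>\<^sub>2 us vs ws.
        us \<noteq> [] \<longrightarrow> vs \<noteq> [] \<longrightarrow> ws \<noteq> [] \<longrightarrow>
        (\<alpha>, us @ vs @ ws, \<beta>) \<in> transitions B \<longrightarrow>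
        (\<alpha>, us, \<nu>\<^sub>1) \<in> transitions B \<longrightarrow>
        (\<nu>\<^sub>1, vs @ ws, \<beta>) \<in> transitions B \<longrightarrow>
        (\<alpha>, us @ vs, \<nu>\<^sub>2) \<in> transitions B \<longrightarrow>
        (\<nu>\<^sub>2, ws, \<beta>) \<in> transitions B \<longrightarrow>
        (\<nu>\<^sub>1, vs, \<nu>\<^sub>2) \<in> transitions B"
    proof (intro allI impI)
      fix \<alpha> \<beta> \<nu>\<^sub>1 \<nu>\<^sub>2 us vs ws
      assume "us \<noteq> []" "vs \<noteq> []" "ws \<noteq> []"
        "(\<alpha>, us @ vs @ ws, \<beta>) \<in> transitions B" "(\<alpha>, us, \<nu>\<^sub>1) \<in> transitions B"
        "(\<nu>\<^sub>1, vs @ ws, \<beta>) \<in> transitions B" "(\<alpha>, us @ vs, \<nu>\<^sub>2) \<in> transitions B"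
        "(\<nu>\<^sub>2, ws, \<beta>) \<in> transitions B"
      then show "(\<nu>\<^sub>1, vs, \<nu>\<^sub>2) \<in> transitions B"
        using weak_hdtsD(4)[OF X, of us vs ws \<alpha> \<beta> \<nu>\<^sub>1 \<nu>\<^sub>2] by (simp add: B_def)
    qed
  qed (simp add: B_def)
  have BX: "subobject B X"
    using wB by (auto simp: subobject_def B_def L_def)
  have "subobject A B" if "subcube A X" for A
  proof -
    obtain xs c where c: "whdts_map (cube xs) X c" and A: "is_image (cube xs) X c A"
      using \<open>subcube A X\<close> unfolding subcube_def by blast
    have L: "snd c v \<in> L" if v: "v \<in> actions (cube xs)" for v
    proof -
      obtain i where "i < length xs" "v = (xs ! i, i)"
        using v by (auto simp: cube_sel)
      then show ?thesis
        using whdts_mapD(4)[OF c cube_action_step[of i xs]] whdts_map_mem(2)[OF c v]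
        by (auto simp: L_def)
    qed
    have "whdts_map (cube xs) B c"
    proof (rule whdts_mapI)
      fix \<alpha> us \<beta> assume t: "(\<alpha>, us, \<beta>) \<in> transitions (cube xs)"
      then have "set us \<subseteq> actions (cube xs)"
        by (rule cube_transitionE)
      then show "(fst c \<alpha>, map (snd c) us, fst c \<beta>) \<in> transitions B"
        using whdts_mapD(4)[OF c t] L by (auto simp: B_def)
    qed (use L whdts_map_mem[OF c] whdts_mapD[OF c] in \<open>auto simp: B_def PiE_def\<close>)
    then show ?thesis
      using A BX by (auto simp: is_image_def)
  qed
  then have "subobject X B"
    using un BX by (auto simp: is_union_def)
  then show ?thesis
    using assms(2) by (auto simp: subobject_def B_def L_def)
qed

text \<open>
  A disjoint union of one-state systems; the action \<open>u\<close> lives at the state \<open>b u\<close>. Special cases are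
  discrete systems (no actions), chaotic ones (one state), and disjoint unions of loops.
\<close>

definition bouquet :: "'s set \<Rightarrow> 'a set \<Rightarrow> ('a \<Rightarrow> 'l) \<Rightarrow> ('a \<Rightarrow> 's) \<Rightarrow> ('s, 'a, 'l) whdts" where
  "bouquet S A lab b = \<lparr>
     states = S,
     actions = A,
     label = restrict lab A,
     transitions = {(s, us, s) | s us. s \<in> S \<and> us \<noteq> [] \<and> set us \<subseteq> A \<and> (\<forall>u \<in> set us. b u = s)}\<rparr>"

lemma bouquet_sel [simp]:
  "states (bouquet S A lab b) = S"
  "actions (bouquet S A lab b) = A"
  "label (bouquet S A lab b) = restrict lab A"
  "(\<alpha>, us, \<beta>) \<in> transitions (bouquet S A lab b) \<longleftrightarrow>
     \<alpha> \<in> S \<and> \<beta> = \<alpha> \<and> us \<noteq> [] \<and> set us \<subseteq> A \<and> (\<forall>u \<in> set us. b u = \<alpha>)"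
  by (auto simp: bouquet_def)

text \<open>A transition with list \<open>us\<close> is the image of the long diagonal of the cube
  on the labels of \<open>us\<close>: all vertices go to its state, and direction \<open>i\<close>
  goes to \<open>us ! i\<close>. Repetitions in \<open>us\<close> are harmless because the
  directions of a cube are numbered.\<close>

lemma cubical_bouquet:
  fixes S :: "'s set" and A :: "'a set"
  assumes b: "b \<in> A \<rightarrow> S"
  shows "cubical (bouquet S A (lab :: 'a \<Rightarrow> 'l) b)" (is "cubical ?X")
proof (rule cubicalI)
  show "weak_hdts ?X"
    unfolding weak_hdts_def by (auto, metis length_0_conv length_permute_list)
  show "\<exists>\<alpha> us \<beta>. (\<alpha>, us, \<beta>) \<in> transitions ?X \<and> u \<in> set us" if "u \<in> actions ?X" for u
    using that b by (intro exI[of _ "b u"] exI[of _ "[u]"]) auto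
  fix \<alpha> us \<beta> assume t: "(\<alpha>, us, \<beta>) \<in> transitions ?X"
  let ?xs = "map lab us"
  define c where "c = (restrict (\<lambda>_ :: bool list. \<alpha>) (states (cube ?xs)),
    restrict (\<lambda>(_ :: 'l, i). us ! i) (actions (cube ?xs)))"
  have "us \<noteq> []" "set us \<subseteq> A"
    using t by auto
  have "whdts_map (cube ?xs) ?X c"
  proof (rule whdts_mapI)
    fix v assume "v \<in> actions (cube ?xs)"
    then obtain i where i: "i < length us" "v = (?xs ! i, i)"
      unfolding cube_sel by auto
    then have "snd c v = us ! i" "us ! i \<in> A"
      using \<open>set us \<subseteq> A\<close> by (auto simp: c_def cube_sel)
    then show "snd c v \<in> actions ?X" "label ?X (snd c v) = label (cube ?xs) v"
      using i cube_sel(3)[of i ?xs] by simp_all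
  next
    fix \<epsilon> vs \<epsilon>' assume v: "(\<epsilon>, vs, \<epsilon>') \<in> transitions (cube ?xs)"
    then obtain js where js: "vs = map (\<lambda>i. (?xs ! i, i)) js" "js \<noteq> []" "set js \<subseteq> {..<length ?xs}"
      and mem: "\<epsilon> \<in> states (cube ?xs)" "\<epsilon>' \<in> states (cube ?xs)"
      by (rule cube_transitionE)
    have "snd c (?xs ! i, i) = us ! i" if "i \<in> set js" for i
    proof -
      have "(?xs ! i, i) \<in> actions (cube ?xs)"
        using js(3) that unfolding cube_sel by blast
      then show ?thesis
        by (simp add: c_def)
    qed
    then have "map (snd c) vs = map (\<lambda>i. us ! i) js"
      unfolding js(1) by simp
    moreover have "set (map (\<lambda>i. us ! i) js) \<subseteq> set us"
      using js by (auto simp: subset_iff)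
    moreover have "fst c \<epsilon> = \<alpha>" "fst c \<epsilon>' = \<alpha>"
      using mem by (simp_all add: c_def)
    ultimately show "(fst c \<epsilon>, map (snd c) vs, fst c \<epsilon>') \<in> transitions ?X"
      using t js(2) by (auto simp: subset_iff)
  qed (use t in \<open>auto simp: c_def\<close>)
  moreover have "(origin ?xs, map (\<lambda>i. (?xs ! i, i)) [0..<length ?xs], replicate (length ?xs) True)
      \<in> transitions (cube ?xs)"
    using \<open>us \<noteq> []\<close> by (intro cube_long_transition) simp
  moreover have "us = map (snd c) (map (\<lambda>i. (?xs ! i, i)) [0..<length ?xs])"
    by (rule nth_equalityI) (auto simp: c_def cube_sel)
  moreover have "\<alpha> = fst c (origin ?xs)" "\<beta> = fst c (replicate (length ?xs) True)"
    using t by (auto simp: c_def cube_sel)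
  ultimately show "\<exists>xs c \<epsilon> vs \<epsilon>'. whdts_map (cube xs) ?X c \<and>
      (\<epsilon>, vs, \<epsilon>') \<in> transitions (cube xs) \<and>
      \<alpha> = fst c \<epsilon> \<and> us = map (snd c) vs \<and> \<beta> = fst c \<epsilon>'"
    by blast
qed

lemma whdts_map_bouquetI:
  assumes X: "weak_hdts X"
    and "f0 \<in> states X \<rightarrow>\<^sub>E S" "f1 \<in> actions X \<rightarrow>\<^sub>E A"
    and "\<And>u. u \<in> actions X \<Longrightarrow> lab (f1 u) = label X u"
    and "\<And>\<alpha> us \<beta> u. (\<alpha>, us, \<beta>) \<in> transitions X \<Longrightarrow> u \<in> set us \<Longrightarrow>
      f0 \<beta> = f0 \<alpha> \<and> b (f1 u) = f0 \<alpha>"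
  shows "whdts_map X (bouquet S A lab b) (f0, f1)"
proof (rule whdts_mapI)
  fix \<alpha> us \<beta> assume t: "(\<alpha>, us, \<beta>) \<in> transitions X"
  have mem: "\<alpha> \<in> states X" "us \<noteq> []" "set us \<subseteq> actions X"
    using weak_hdtsD(2)[OF X t] by blast+
  then have "f0 \<beta> = f0 \<alpha>" "\<forall>u \<in> set us. b (f1 u) = f0 \<alpha>"
    using assms(5)[OF t hd_in_set] assms(5)[OF t] by blast+
  then show "(fst (f0, f1) \<alpha>, map (snd (f0, f1)) us, fst (f0, f1) \<beta>)
      \<in> transitions (bouquet S A lab b)"
    using mem assms(2,3) by auto
qed (use assms(2-4) in \<open>auto simp: PiE_def Pi_def\<close>)

lemma CTS_cubical: "X \<in> CTS \<Longrightarrow> cubical X" and CTS_weak_hdts: "X \<in> CTS \<Longrightarrow> weak_hdts X"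
  by (simp_all add: CTS_def cubical_def)

lemma CTS_arrowsD:
  assumes "(X, f, Y) \<in> CTS_arrows"
  shows "X \<in> CTS" "Y \<in> CTS" "whdts_map X Y f"
  using assms by (simp_all add: CTS_arrows_def)

lemma bouquet_in_CTS:
  fixes S A :: "'u set"
  assumes "S \<prec> (UNIV :: 'u set)" "A \<prec> (UNIV :: 'u set)" "b \<in> A \<rightarrow> S"
  shows "bouquet S A lab b \<in> CTS"
  using assms cubical_bouquet by (auto simp: CTS_def)

lemma finite_lesspoll_UNIV:
  "finite A \<Longrightarrow> infinite (UNIV :: 'u set) \<Longrightarrow> A \<prec> (UNIV :: 'u set)"
  by (simp add: finite_lesspoll_infinite)

text \<open>Needed for adjoining one fresh action to an object; infinity of the universe is what
  preserves smallness.\<close>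

lemma insert_lesspoll_UNIV:
  assumes "A \<prec> (UNIV :: 'u set)" "infinite (UNIV :: 'u set)"
  shows "insert a A \<prec> (UNIV :: 'u set)"
proof (cases "finite A")
  case True
  then show ?thesis
    using assms(2) by (simp add: finite_lesspoll_infinite)
next
  case False
  then show ?thesis
    using assms(1) infinite_insert_eqpoll eq_lesspoll_trans by metis
qed

section \<open>Pushouts and transfinite compositions of cofibrations\<close>

text \<open>
  Given a map \<open>f : D \<rightarrow> C\<close>, the marking redirects the actions satisfying \<open>P\<close>, all of label \<open>l\<close>, to
  a fresh action \<open>e\<close>. It makes it possible to test injectivity on actions of a map into a colimit
  using the universal property alone, in a universe whose cardinality need not be inaccessible.
\<close>

definition marked :: "('u, 'u, 'l) whdts \<Rightarrow> 'u \<Rightarrow> 'l \<Rightarrow> ('u, 'u, 'l) whdts" where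
  "marked C e l = bouquet {e} (insert e (actions C)) ((label C)(e := l)) (\<lambda>_. e)"

definition marking ::
  "('s, 'a, 'l) whdts \<Rightarrow> ('s, 'a, 'u, 'u) map_pair \<Rightarrow> 'u \<Rightarrow> ('a \<Rightarrow> bool) \<Rightarrow>
   ('s, 'a, 'u, 'u) map_pair" where
  "marking D f e P =
     (restrict (\<lambda>_. e) (states D), restrict (\<lambda>u. if P u then e else snd f u) (actions D))"

lemma marked_in_CTS:
  assumes "infinite (UNIV :: 'u set)" "(C :: ('u, 'u, 'l) whdts) \<in> CTS"
  shows "marked C e l \<in> CTS"
  using assms insert_lesspoll_UNIV[of "actions C" e] finite_lesspoll_UNIV[of "{e}"]
  unfolding marked_def by (intro bouquet_in_CTS) (auto simp: CTS_def)

text \<open>With a single state and all nonempty lists as loops, the target constrains only labels.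
  Redirected actions carry the label \<open>l\<close> given to \<open>e\<close>, and freshness of
  \<open>e\<close> leaves the other labels as they were.\<close>

lemma whdts_map_marking:
  assumes D: "weak_hdts D" and f: "whdts_map D C f" and e: "e \<notin> actions C"
    and P: "\<And>u. u \<in> actions D \<Longrightarrow> P u \<Longrightarrow> label D u = l"
  shows "whdts_map D (marked C e l) (marking D f e P)"
  unfolding marked_def marking_def
proof (rule whdts_map_bouquetI[OF D])
  show "restrict (\<lambda>u. if P u then e else snd f u) (actions D) \<in>
      actions D \<rightarrow>\<^sub>E insert e (actions C)"
    using whdts_map_mem(2)[OF f] by auto
  fix u assume u: "u \<in> actions D"
  then have "snd f u \<noteq> e"
    using whdts_map_mem(2)[OF f] e by auto
  then show "((label C)(e := l)) (restrict (\<lambda>u. if P u then e else snd f u) (actions D) u) =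
      label D u"
    using u P whdts_mapD(3)[OF f] by simp
next
  fix \<alpha> us \<beta> u assume "(\<alpha>, us, \<beta>) \<in> transitions D"
  then show "restrict (\<lambda>_. e) (states D) \<beta> = restrict (\<lambda>_. e) (states D) \<alpha> \<and>
      e = restrict (\<lambda>_. e) (states D) \<alpha>"
    using weak_hdtsD(2)[OF D] by auto
qed auto

text \<open>This turns markings of the objects of a diagram into a cocone, provided that the
  predicates correspond along each of its maps.\<close>

lemma comp_map_marking:
  assumes g: "whdts_map D D' g" and f: "comp_map D f' g = f"
    and P: "\<And>u. u \<in> actions D \<Longrightarrow> P u \<longleftrightarrow> P' (snd g u)"
  shows "comp_map D (marking D' f' e P') g = marking D f e P"
proof (rule prod_eqI)
  show "fst (comp_map D (marking D' f' e P') g) = fst (marking D f e P)"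
    using whdts_map_mem(1)[OF g] by (auto simp: comp_map_def marking_def compose_def)
  show "snd (comp_map D (marking D' f' e P') g) = snd (marking D f e P)"
    using whdts_map_mem(2)[OF g] P
    by (auto simp: comp_map_def marking_def compose_def fun_eq_iff f[symmetric])
qed

lemma CTS_fresh_action:
  assumes "(C :: ('u, 'u, 'l) whdts) \<in> CTS"
  obtains e where "e \<notin> actions C"
proof -
  have "actions C \<noteq> UNIV"
    using assms by (auto simp: CTS_def)
  then show ?thesis
    using that by blast
qed

text \<open>Suppose that \<open>k\<close> identifies \<open>a\<close> and \<open>b\<close>. On
  \<open>Z\<close> mark \<open>a\<close> alone, and on \<open>Y\<close> mark the images under
  \<open>f\<close> of whatever \<open>g\<close> sends to \<open>a\<close>; injectivity of
  \<open>f\<close> makes the square commute. The induced map on \<open>P\<close> would have to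
  separate \<open>snd k a\<close> from \<open>snd k b\<close>, since \<open>k'\<close> sends
  \<open>a\<close> to the fresh \<open>e\<close> and \<open>b\<close> to an action of
  \<open>P\<close>.\<close>

lemma pushout_inj_on_actions:
  fixes X :: "('u, 'u, 'l) whdts"
  assumes inf: "infinite (UNIV :: 'u set)" and po: "is_pushout X f Y g Z h k P"
    and inj: "inj_on (snd f) (actions X)"
  shows "inj_on (snd k) (actions Z)"
proof (rule inj_onI, rule ccontr)
  fix a b assume a: "a \<in> actions Z" and b: "b \<in> actions Z" and ab: "snd k a = snd k b" "a \<noteq> b"
  have arr: "(X, f, Y) \<in> CTS_arrows" "(X, g, Z) \<in> CTS_arrows" "(Y, h, P) \<in> CTS_arrows"
    "(Z, k, P) \<in> CTS_arrows" and comm: "comp_map X h f = comp_map X k g"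
    and univ: "\<And>Q h' k'. (Y, h', Q) \<in> CTS_arrows \<Longrightarrow> (Z, k', Q) \<in> CTS_arrows \<Longrightarrow>
        comp_map X h' f = comp_map X k' g \<Longrightarrow> \<exists>l. comp_map Z l k = k'"
    using po unfolding is_pushout_def by blast+
  note D = arr[THEN CTS_arrowsD(1)] arr[THEN CTS_arrowsD(2)] and m = arr[THEN CTS_arrowsD(3)]
  obtain e where e: "e \<notin> actions P"
    using CTS_fresh_action[OF D(7)] .
  define h' where "h' = marking Y h e (\<lambda>y. \<exists>x \<in> actions X. y = snd f x \<and> snd g x = a)"
  define k' where "k' = marking Z k e (\<lambda>z. z = a)"
  let ?Q = "marked P e (label Z a)"
  have lab: "label Y (snd f x) = label Z (snd g x)" if "x \<in> actions X" for x
    using whdts_mapD(3)[OF m(1) that] whdts_mapD(3)[OF m(2) that] by simp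
  have "comp_map X h' f = marking X (comp_map X h f) e (\<lambda>x. snd g x = a)"
    unfolding h'_def
    by (rule comp_map_marking[OF m(1) refl]) (use inj in \<open>auto dest: inj_onD\<close>)
  moreover have "comp_map X k' g = marking X (comp_map X h f) e (\<lambda>x. snd g x = a)"
    unfolding k'_def by (rule comp_map_marking[OF m(2) comm[symmetric]]) simp
  moreover have "whdts_map Y ?Q h'" "whdts_map Z ?Q k'"
    unfolding h'_def k'_def
    using lab by (auto intro!: whdts_map_marking m e CTS_weak_hdts D)
  ultimately obtain l where l: "comp_map Z l k = k'"
    using univ[of h' ?Q k'] marked_in_CTS[OF inf D(7)] D by (auto simp: CTS_arrows_def)
  have "snd k' a = snd k' b"
    using comp_map_apply(2)[OF a, of l k] comp_map_apply(2)[OF b, of l k] ab(1) by (simp add: l)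
  then show False
    using a b ab(2) e whdts_map_mem(2)[OF m(4) b] by (auto simp: k'_def marking_def)
qed

section \<open>Sequences indexed by well-orders and colimits of chains\<close>

lemma is_lambda_sequenceD:
  assumes "is_lambda_sequence r D \<phi>"
  shows "Well_order r"
    and "(i, j) \<in> r \<Longrightarrow> (D i, \<phi> i j, D j) \<in> CTS_arrows"
    and "i \<in> Field r \<Longrightarrow> \<phi> i i = id_map (D i)"
    and "(i, j) \<in> r \<Longrightarrow> (j, k) \<in> r \<Longrightarrow> comp_map (D i) (\<phi> j k) (\<phi> i j) = \<phi> i k"
    and "is_limit_elem r j \<Longrightarrow>
      is_colimit (underS r j) D (chain_maps r \<phi> (underS r j)) (D j) (\<lambda>i. \<phi> i j)"
  using assms unfolding is_lambda_sequence_def by blast+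

lemma is_lambda_sequence_order:
  assumes "is_lambda_sequence r D \<phi>"
  shows "i \<in> Field r \<Longrightarrow> (i, i) \<in> r"
    and "i \<in> Field r \<Longrightarrow> j \<in> Field r \<Longrightarrow> (i, j) \<in> r \<or> (j, i) \<in> r"
    and "(i, j) \<in> r \<Longrightarrow> (j, k) \<in> r \<Longrightarrow> (i, k) \<in> r"
proof -
  have "Refl r" "Total r" "trans r"
    using is_lambda_sequenceD(1)[OF assms] by (simp_all add: order_on_defs)
  then show "i \<in> Field r \<Longrightarrow> (i, i) \<in> r"
    "i \<in> Field r \<Longrightarrow> j \<in> Field r \<Longrightarrow> (i, j) \<in> r \<or> (j, i) \<in> r"
    "(i, j) \<in> r \<Longrightarrow> (j, k) \<in> r \<Longrightarrow> (i, k) \<in> r"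
    unfolding refl_on_def total_on_def by (blast, metis, blast dest: transD)
qed

lemma is_cocone_chain:
  assumes "is_cocone J D (chain_maps r \<phi> J) C \<iota>"
  shows "i \<in> J \<Longrightarrow> whdts_map (D i) C (\<iota> i)"
    and "i \<in> J \<Longrightarrow> j \<in> J \<Longrightarrow> (i, j) \<in> r \<Longrightarrow> comp_map (D i) (\<iota> j) (\<phi> i j) = \<iota> i"
  using assms unfolding is_cocone_def chain_maps_def by blast+

lemma is_cocone_chainI:
  assumes "\<And>i. i \<in> J \<Longrightarrow> whdts_map (D i) C (\<iota> i)"
    and "\<And>i j. i \<in> J \<Longrightarrow> j \<in> J \<Longrightarrow> (i, j) \<in> r \<Longrightarrow> comp_map (D i) (\<iota> j) (\<phi> i j) = \<iota> i"
  shows "is_cocone J D (chain_maps r \<phi> J) C \<iota>"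
  using assms unfolding is_cocone_def chain_maps_def by blast

lemma is_colimitD:
  fixes C :: "('u, 'u, 'l) whdts"
  assumes "is_colimit I D E C \<iota>"
  shows "C \<in> CTS" "is_cocone I D E C \<iota>"
    and "(C' :: ('u, 'u, 'l) whdts) \<in> CTS \<Longrightarrow> is_cocone I D E C' \<iota>' \<Longrightarrow>
      \<exists>h. whdts_map C C' h \<and> (\<forall>i \<in> I. comp_map (D i) h (\<iota> i) = \<iota>' i)"
    and "(C' :: ('u, 'u, 'l) whdts) \<in> CTS \<Longrightarrow> is_cocone I D E C' \<iota>' \<Longrightarrow>
      whdts_map C C' h \<Longrightarrow> \<forall>i \<in> I. comp_map (D i) h (\<iota> i) = \<iota>' i \<Longrightarrow>
      whdts_map C C' h' \<Longrightarrow> \<forall>i \<in> I. comp_map (D i) h' (\<iota> i) = \<iota>' i \<Longrightarrow> h = h'"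
proof -
  note * = assms[unfolded is_colimit_def]
  show "C \<in> CTS" "is_cocone I D E C \<iota>"
    using * by blast+
  have ex1: "\<exists>!h. whdts_map C C' h \<and> (\<forall>i \<in> I. comp_map (D i) h (\<iota> i) = \<iota>' i)"
    if "C' \<in> CTS" "is_cocone I D E C' \<iota>'"
    using *[THEN conjunct2, THEN conjunct2, THEN bspec, OF that(1), THEN spec, THEN mp, OF that(2)] .
  show "C' \<in> CTS \<Longrightarrow> is_cocone I D E C' \<iota>' \<Longrightarrow>
      \<exists>h. whdts_map C C' h \<and> (\<forall>i \<in> I. comp_map (D i) h (\<iota> i) = \<iota>' i)"
    using ex1 by (rule ex1_implies_ex)
  show "C' \<in> CTS \<Longrightarrow> is_cocone I D E C' \<iota>' \<Longrightarrow>
      whdts_map C C' h \<Longrightarrow> \<forall>i \<in> I. comp_map (D i) h (\<iota> i) = \<iota>' i \<Longrightarrow>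
      whdts_map C C' h' \<Longrightarrow> \<forall>i \<in> I. comp_map (D i) h' (\<iota> i) = \<iota>' i \<Longrightarrow> h = h'"
    using ex1 by blast
qed

text \<open>The same test as for pushouts, marking at each stage the actions that eventually meet
  \<open>a\<close>. Totality of the order makes this compatible with the chain maps, and injectivity
  of the maps out of \<open>D j\<close> keeps \<open>b\<close> from ever meeting
  \<open>a\<close>.\<close>

lemma chain_colimit_inj_on_actions:
  fixes D :: "'u \<Rightarrow> ('u, 'u, 'l) whdts" and C :: "('u, 'u, 'l) whdts"
  assumes inf: "infinite (UNIV :: 'u set)" and seq: "is_lambda_sequence r D \<phi>" and J: "J \<subseteq> Field r"
    and col: "is_colimit J D (chain_maps r \<phi> J) C \<iota>" and j: "j \<in> J"
    and inj: "\<And>m. m \<in> J \<Longrightarrow> (j, m) \<in> r \<Longrightarrow> inj_on (snd (\<phi> j m)) (actions (D j))"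
  shows "inj_on (snd (\<iota> j)) (actions (D j))"
proof (rule inj_onI, rule ccontr)
  fix a b assume a: "a \<in> actions (D j)" and b: "b \<in> actions (D j)"
    and ab: "snd (\<iota> j) a = snd (\<iota> j) b" "a \<noteq> b"
  note ord = is_lambda_sequence_order[OF seq]
  note arr = is_lambda_sequenceD(2)[OF seq, THEN CTS_arrowsD(3)]
  note comp = is_lambda_sequenceD(4)[OF seq]
  note coc = is_cocone_chain[OF is_colimitD(2)[OF col]]
  have CTS_D: "D i \<in> CTS" if "i \<in> J" for i
    using that J ord(1)[of i] is_lambda_sequenceD(2)[OF seq, THEN CTS_arrowsD(1)] by blast
  obtain e where e: "e \<notin> actions C"
    using CTS_fresh_action[OF is_colimitD(1)[OF col]] .
  \<comment> \<open>The stage \<open>m\<close> lies above both \<open>i\<close> and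
    \<open>j\<close>, because \<open>J\<close> may contain stages below \<open>j\<close>.\<close>
  define P where "P i u \<longleftrightarrow>
    (\<exists>m \<in> J. (i, m) \<in> r \<and> (j, m) \<in> r \<and> snd (\<phi> i m) u = snd (\<phi> j m) a)" for i u
  define \<iota>' where "\<iota>' i = marking (D i) (\<iota> i) e (P i)" for i
  let ?Q = "marked C e (label (D j) a)"
  have "is_cocone J D (chain_maps r \<phi> J) ?Q \<iota>'"
  proof (rule is_cocone_chainI)
    fix i assume i: "i \<in> J"
    show "whdts_map (D i) ?Q (\<iota>' i)"
      unfolding \<iota>'_def
    proof (rule whdts_map_marking[OF CTS_weak_hdts[OF CTS_D[OF i]] coc(1)[OF i] e])
      fix u assume u: "u \<in> actions (D i)" and "P i u"
      then obtain m where "(i, m) \<in> r" "(j, m) \<in> r" "snd (\<phi> i m) u = snd (\<phi> j m) a"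
        unfolding P_def by blast
      then show "label (D i) u = label (D j) a"
        using whdts_mapD(3)[OF arr u] whdts_mapD(3)[OF arr a] by metis
    qed
    fix i' assume i': "i' \<in> J" and ii': "(i, i') \<in> r"
    show "comp_map (D i) (\<iota>' i') (\<phi> i i') = \<iota>' i"
      unfolding \<iota>'_def
    proof (rule comp_map_marking[OF arr[OF ii'] coc(2)[OF i i' ii']])
      fix u assume u: "u \<in> actions (D i)"
      have u': "snd (\<phi> i' m) (snd (\<phi> i i') u) = snd (\<phi> i m) u" if "(i', m) \<in> r" for m
        using comp[OF ii' that] comp_map_apply(2)[OF u, of "\<phi> i' m" "\<phi> i i'"] by simp
      show "P i u \<longleftrightarrow> P i' (snd (\<phi> i i') u)"
      proof
        assume "P i u"
        then obtain m where m: "m \<in> J" "(i, m) \<in> r" "(j, m) \<in> r" "snd (\<phi> i m) u = snd (\<phi> j m) a"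
          unfolding P_def by blast
        have "m \<in> Field r" "i' \<in> Field r"
          using m(1) i' J by blast+
        \<comment> \<open>\<open>n\<close> is the larger of \<open>m\<close> and \<open>i'\<close>:
          an equality reached at \<open>m\<close> persists to a stage above
          \<open>i'\<close>.\<close>
        then obtain n where n: "n \<in> J" "(m, n) \<in> r" "(i', n) \<in> r"
          using ord(1,2) m(1) i' by metis
        have "snd (\<phi> i n) u = snd (\<phi> m n) (snd (\<phi> i m) u)"
          using comp[OF m(2) n(2)] comp_map_apply(2)[OF u] by metis
        also have "\<dots> = snd (\<phi> j n) a"
          unfolding m(4) using comp[OF m(3) n(2)] comp_map_apply(2)[OF a] by metis
        finally show "P i' (snd (\<phi> i i') u)"
          unfolding P_def using n u' ord(3)[OF m(3) n(2)] by auto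
      next
        assume "P i' (snd (\<phi> i i') u)"
        then show "P i u"
          unfolding P_def using u' ord(3)[OF ii'] by metis
      qed
    qed
  qed
  then obtain l where "\<forall>i \<in> J. comp_map (D i) l (\<iota> i) = \<iota>' i"
    using is_colimitD(3)[OF col marked_in_CTS[OF inf is_colimitD(1)[OF col]]] by blast
  then have l: "comp_map (D j) l (\<iota> j) = \<iota>' j"
    using j by blast
  have "snd (\<iota>' j) a = snd (\<iota>' j) b"
    using comp_map_apply(2)[OF a, of l "\<iota> j"] comp_map_apply(2)[OF b, of l "\<iota> j"] ab(1)
    by (simp add: l)
  moreover have "P j a"
    unfolding P_def using j J ord(1) by blast
  moreover have "\<not> P j b"
    unfolding P_def using inj a b ab(2) by (auto dest: inj_onD)
  ultimately show False
    using a b e whdts_map_mem(2)[OF coc(1)[OF j] b] by (auto simp: \<iota>'_def marking_def)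
qed

text \<open>Well-founded induction puts the map from the first stage to every stage into
  \<open>\<K>\<close>. The set \<open>J\<close> is arbitrary so that \<open>colim\<close> serves
  both the limit stages, with \<open>J = underS r k\<close>, and the final colimit, with
  \<open>J = Field r\<close>.\<close>

lemma closed_under_transfinite_compositionI:
  fixes \<K> :: "('u, 'l) arrow set"
  assumes id: "\<And>X. X \<in> CTS \<Longrightarrow> (X, id_map X, X) \<in> \<K>"
    and comp: "\<And>X f Y g Z. (X, f, Y) \<in> \<K> \<Longrightarrow> (Y, g, Z) \<in> \<K> \<Longrightarrow> (X, comp_map X g f, Z) \<in> \<K>"
    and colim: "\<And>r D \<phi> J (C :: ('u, 'u, 'l) whdts) \<iota> j. is_lambda_sequence r D \<phi> \<Longrightarrow> J \<subseteq> Field r \<Longrightarrow>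
      is_colimit J D (chain_maps r \<phi> J) C \<iota> \<Longrightarrow> j \<in> J \<Longrightarrow>
      (\<And>m. m \<in> J \<Longrightarrow> (j, m) \<in> r \<and> (D j, \<phi> j m, D m) \<in> \<K>) \<Longrightarrow> (D j, \<iota> j, C) \<in> \<K>"
  shows "closed_under_transfinite_composition \<K>"
  unfolding closed_under_transfinite_composition_def
proof (intro allI impI)
  fix r :: "'u rel" and D \<phi> \<iota> i\<^sub>0 and C :: "('u, 'u, 'l) whdts"
  assume seq: "is_lambda_sequence r D \<phi>"
    and succ: "\<forall>i j. is_succ_pair r i j \<longrightarrow> (D i, \<phi> i j, D j) \<in> \<K>"
    and col: "is_colimit (Field r) D (chain_maps r \<phi> (Field r)) C \<iota>"
    and i\<^sub>0: "i\<^sub>0 \<in> Field r" "underS r i\<^sub>0 = {}"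
  note ord = is_lambda_sequence_order[OF seq]
  have least: "(i\<^sub>0, k) \<in> r" if "k \<in> Field r" for k
    using ord(1)[OF i\<^sub>0(1)] ord(2)[OF i\<^sub>0(1) that] i\<^sub>0(2) by (auto simp: underS_def)
  have wf: "wf (r - Id)"
    using is_lambda_sequenceD(1)[OF seq] by (simp add: well_order_on_def)
  have under: "k \<in> underS r k' \<longleftrightarrow> (k, k') \<in> r \<and> k \<noteq> k'" for k k'
    by (auto simp: underS_def)
  have "k \<in> Field r \<longrightarrow> (D i\<^sub>0, \<phi> i\<^sub>0 k, D k) \<in> \<K>" for k
  proof (induction k rule: wf_induct_rule[OF wf])
    case (1 k)
    show ?case
    proof
      assume k: "k \<in> Field r"
      have IH: "(D i\<^sub>0, \<phi> i\<^sub>0 m, D m) \<in> \<K>" if "m \<in> underS r k" for m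
        using 1[of m] that by (auto simp: under Field_def)
      \<comment> \<open>Apart from the least element, failure to be a limit gives an
        \<open>i\<close> below \<open>k\<close> with nothing below \<open>k\<close> strictly above
        it; by totality \<open>k\<close> is the successor of \<open>i\<close>.\<close>
      consider "k = i\<^sub>0" | i where "i \<in> underS r k" "\<forall>m \<in> underS r k. i \<notin> underS r m"
        | "is_limit_elem r k"
        using k least[OF k] unfolding is_limit_elem_def by (metis under empty_iff)
      then show "(D i\<^sub>0, \<phi> i\<^sub>0 k, D k) \<in> \<K>"
      proof cases
        case 1
        have "D i\<^sub>0 \<in> CTS"
          using CTS_arrowsD(1)[OF is_lambda_sequenceD(2)[OF seq least[OF i\<^sub>0(1)]]] .
        then show ?thesis
          using id is_lambda_sequenceD(3)[OF seq i\<^sub>0(1)] by (simp add: 1)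
      next
        case 2
        have "(m, i) \<in> r" if "m \<in> underS r k" for m
        proof -
          have "m \<in> Field r" "i \<in> Field r"
            using that 2(1) by (auto simp: under Field_def)
          then show ?thesis
            using ord(1,2) 2(2) that by (metis under)
        qed
        then have "is_succ_pair r i k"
          using 2(1) by (simp add: is_succ_pair_def)
        then have "(D i\<^sub>0, comp_map (D i\<^sub>0) (\<phi> i k) (\<phi> i\<^sub>0 i), D k) \<in> \<K>"
          using comp[OF IH[OF 2(1)]] succ by blast
        moreover have "(i, k) \<in> r" "i \<in> Field r"
          using 2(1) by (auto simp: under Field_def)
        ultimately show ?thesis
          using is_lambda_sequenceD(4)[OF seq least] by simp
      next
        case 3
        have "k \<noteq> i\<^sub>0"
          using 3 i\<^sub>0(2) by (auto simp: is_limit_elem_def)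
        then have "i\<^sub>0 \<in> underS r k"
          using least[OF k] by (simp add: under)
        moreover have sub: "underS r k \<subseteq> Field r"
          by (auto simp: under Field_def)
        ultimately show ?thesis
          using colim[OF seq sub is_lambda_sequenceD(5)[OF seq 3], of i\<^sub>0] IH least by blast
      qed
    qed
  qed
  then show "(D i\<^sub>0, \<iota> i\<^sub>0, C) \<in> \<K>"
    using colim[OF seq subset_refl col i\<^sub>0(1)] least by blast
qed


section \<open>The maps inverted by a representable functor\<close>

text \<open>These are the maps orthogonal to \<open>Z\<close>: each map \<open>X -> Z\<close>
  extends uniquely along \<open>f\<close>.\<close>

definition inverted_by :: "('u, 'u, 'l) whdts \<Rightarrow> ('u, 'l) arrow set" where
  "inverted_by Z = {(X, f, Y) \<in> CTS_arrows.
     bij_betw (\<lambda>h. comp_map X h f) {h. whdts_map Y Z h} {h. whdts_map X Z h}}"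

lemma inverted_byI:
  assumes f: "(X, f, Y) \<in> CTS_arrows"
    and "\<And>g. whdts_map X Z g \<Longrightarrow> \<exists>h. whdts_map Y Z h \<and> comp_map X h f = g"
    and "\<And>h h'. whdts_map Y Z h \<Longrightarrow> whdts_map Y Z h' \<Longrightarrow> comp_map X h f = comp_map X h' f \<Longrightarrow> h = h'"
  shows "(X, f, Y) \<in> inverted_by Z"
proof -
  have "whdts_map X Z (comp_map X h f)" if "whdts_map Y Z h" for h
    using whdts_map_comp CTS_weak_hdts CTS_arrowsD[OF f] that by blast
  then show ?thesis
    using assms unfolding inverted_by_def bij_betw_def inj_on_def by blast
qed

lemma inverted_byD:
  assumes "(X, f, Y) \<in> inverted_by Z"
  shows "(X, f, Y) \<in> CTS_arrows"
    and "whdts_map X Z g \<Longrightarrow> \<exists>h. whdts_map Y Z h \<and> comp_map X h f = g"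
    and "whdts_map Y Z h \<Longrightarrow> whdts_map Y Z h' \<Longrightarrow> comp_map X h f = comp_map X h' f \<Longrightarrow> h = h'"
proof -
  have arr: "(X, f, Y) \<in> CTS_arrows"
    and bij: "bij_betw (\<lambda>h. comp_map X h f) {h. whdts_map Y Z h} {h. whdts_map X Z h}"
    using assms by (simp_all add: inverted_by_def)
  show "(X, f, Y) \<in> CTS_arrows"
    by (rule arr)
  show "whdts_map X Z g \<Longrightarrow> \<exists>h. whdts_map Y Z h \<and> comp_map X h f = g"
    using bij_betw_imp_surj_on[OF bij] by (metis (no_types, lifting) imageE mem_Collect_eq)
  show "whdts_map Y Z h \<Longrightarrow> whdts_map Y Z h' \<Longrightarrow> comp_map X h f = comp_map X h' f \<Longrightarrow> h = h'"
    using inj_onD[OF bij_betw_imp_inj_on[OF bij], of h h'] by simp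
qed

text \<open>Precomposition reverses composites, \<open>?GF = ?F o ?G\<close>, which leaves
  two-out-of-three for bijections.\<close>

lemma two_out_of_three_inverted_by:
  fixes Z :: "('u, 'u, 'l) whdts"
  shows "two_out_of_three (inverted_by Z)"
  unfolding two_out_of_three_def
proof (intro allI impI)
  fix X Y W :: "('u, 'u, 'l) whdts" and f g
  assume f: "(X, f, Y) \<in> CTS_arrows" and g: "(Y, g, W) \<in> CTS_arrows"
  let ?F = "\<lambda>h. comp_map X h f" and ?G = "\<lambda>h. comp_map Y h g"
    and ?GF = "\<lambda>h. comp_map X h (comp_map X g f)"
  note f' = CTS_arrowsD[OF f] and g' = CTS_arrowsD[OF g]
  have gf: "(X, comp_map X g f, W) \<in> CTS_arrows"
    using f' g' whdts_map_comp[OF CTS_weak_hdts f'(3) g'(3)] by (simp add: CTS_arrows_def)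
  have GF: "?GF = ?F \<circ> ?G"
    by (rule ext) (simp add: comp_map_assoc[OF f'(3)])
  have maps: "?F ` {h. whdts_map Y Z h} \<subseteq> {h. whdts_map X Z h}"
    "?G ` {h. whdts_map W Z h} \<subseteq> {h. whdts_map Y Z h}"
    using f' g' whdts_map_comp CTS_weak_hdts by blast+
  have 1: "bij_betw ?GF {h. whdts_map W Z h} {h. whdts_map X Z h}"
    if "bij_betw ?F {h. whdts_map Y Z h} {h. whdts_map X Z h}"
      "bij_betw ?G {h. whdts_map W Z h} {h. whdts_map Y Z h}"
    unfolding GF using that by (intro bij_betw_trans)
  have 2: "bij_betw ?G {h. whdts_map W Z h} {h. whdts_map Y Z h}"
    if "bij_betw ?F {h. whdts_map Y Z h} {h. whdts_map X Z h}"
      "bij_betw ?GF {h. whdts_map W Z h} {h. whdts_map X Z h}"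
    using that unfolding GF by (simp add: bij_betw_comp_iff2[OF _ maps(2)])
  have 3: "bij_betw ?F {h. whdts_map Y Z h} {h. whdts_map X Z h}"
    if "bij_betw ?G {h. whdts_map W Z h} {h. whdts_map Y Z h}"
      "bij_betw ?GF {h. whdts_map W Z h} {h. whdts_map X Z h}"
    using that unfolding GF by (simp add: bij_betw_comp_iff)
  show "((X, f, Y) \<in> inverted_by Z \<and> (Y, g, W) \<in> inverted_by Z \<longrightarrow>
        (X, comp_map X g f, W) \<in> inverted_by Z) \<and>
      ((X, f, Y) \<in> inverted_by Z \<and> (X, comp_map X g f, W) \<in> inverted_by Z \<longrightarrow>
        (Y, g, W) \<in> inverted_by Z) \<and>
      ((Y, g, W) \<in> inverted_by Z \<and> (X, comp_map X g f, W) \<in> inverted_by Z \<longrightarrow>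
        (X, f, Y) \<in> inverted_by Z)"
    using f g gf 1 2 3 unfolding inverted_by_def by simp
qed

text \<open>The square has the discrete system \<open>P\<close> on the states of \<open>X\<close> at
  its upper left, included in \<open>X\<close> and sent to \<open>Y\<close> by \<open>f\<close>, and
  the identity of \<open>Y\<close> at the bottom. Having no actions to identify,
  \<open>P -> Y\<close> is a cofibration even if \<open>f\<close> merges states. The lower triangle
  makes the lift a section, and the upper one makes it invert \<open>f\<close> on states.\<close>

lemma has_rlp_cofibrations_section:
  fixes X :: "('u, 'u, 'l) whdts"
  assumes arr: "(X, f, Y) \<in> CTS_arrows" and rlp: "has_rlp cofibrations (X, f, Y)"
  obtains l where "whdts_map Y X l" "comp_map Y f l = id_map Y"
    "\<And>s. s \<in> states X \<Longrightarrow> fst l (fst f s) = s"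
proof -
  note D = CTS_arrowsD(1,2)[OF arr] and f = CTS_arrowsD(3)[OF arr]
  define P where "P = bouquet (states X) ({} :: 'u set) (\<lambda>_. undefined :: 'l) (\<lambda>_. undefined)"
  have P_sel: "states P = states X" "actions P = {}" "transitions P = {}"
    by (auto simp: P_def bouquet_def)
  have "{} \<prec> (UNIV :: 'u set)"
    using eqpoll_empty_iff_empty[of "UNIV :: 'u set"] eqpoll_sym[of "{}" "UNIV :: 'u set"]
    by (auto simp: lesspoll_def empty_lepoll)
  then have P: "P \<in> CTS"
    using D(1) unfolding P_def by (intro bouquet_in_CTS) (auto simp: CTS_def)
  define i where "i = (fst f, (\<lambda>_. undefined) :: 'u \<Rightarrow> 'u)"
  define a where "a = (restrict id (states X), (\<lambda>_. undefined) :: 'u \<Rightarrow> 'u)"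
  have i: "whdts_map P Y i"
    using whdts_mapD(1)[OF f] by (intro whdts_mapI) (auto simp: P_sel i_def PiE_def)
  have a: "whdts_map P X a"
    by (rule whdts_mapI) (auto simp: P_sel a_def)
  have b: "whdts_map Y Y (id_map Y)"
    by (rule whdts_map_id[OF CTS_weak_hdts[OF D(2)]])
  have "comp_map P f a = comp_map P (id_map Y) i"
    by (rule whdts_map_eqI[OF whdts_map_comp[OF CTS_weak_hdts[OF P] a f]
          whdts_map_comp[OF CTS_weak_hdts[OF P] i b]])
      (auto simp: P_sel comp_map_apply i_def a_def id_map_apply whdts_map_mem[OF f])
  moreover have "(P, i, Y) \<in> cofibrations"
    using P D(2) i by (simp add: cofibrations_def CTS_arrows_def P_sel)
  ultimately obtain l where l: "whdts_map Y X l" "comp_map P l i = a" "comp_map Y f l = id_map Y"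
    using rlp a b unfolding has_rlp_def by blast
  have "fst l (fst f s) = s" if "s \<in> states X" for s
    using comp_map_apply(1)[of s P l i] that l(2) by (simp add: P_sel i_def a_def)
  then show ?thesis
    using that l(1,3) by blast
qed

text \<open>The extension of \<open>g\<close> is \<open>g o l\<close>. For a transition
  \<open>(\<alpha>, [u], \<beta>)\<close> of \<open>X\<close>, the map \<open>l o f\<close> keeps
  both ends, so \<open>g\<close> sends it and its image to transitions of \<open>Z\<close> with the
  same ends, and \<open>det\<close> equates the actions. Uniqueness follows from
  \<open>f o l = id\<close>.\<close>

lemma has_rlp_cofibrations_inverted:
  assumes det: "\<And>\<alpha> u v \<beta>. (\<alpha>, [u], \<beta>) \<in> transitions Z \<Longrightarrow> (\<alpha>, [v], \<beta>) \<in> transitions Z \<Longrightarrow> u = v"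
    and arr: "(X, f, Y) \<in> CTS_arrows" and rlp: "has_rlp cofibrations (X, f, Y)"
  shows "(X, f, Y) \<in> inverted_by Z"
proof -
  note D = CTS_arrowsD(1,2)[OF arr] and f = CTS_arrowsD(3)[OF arr]
  note w = D[THEN CTS_weak_hdts]
  obtain l where l: "whdts_map Y X l" "comp_map Y f l = id_map Y"
    and lf: "\<And>s. s \<in> states X \<Longrightarrow> fst l (fst f s) = s"
    using has_rlp_cofibrations_section[OF arr rlp] by blast
  show ?thesis
  proof (rule inverted_byI[OF arr])
    fix g assume g: "whdts_map X Z g"
    have gl: "whdts_map Y Z (comp_map Y g l)"
      by (rule whdts_map_comp[OF w(2) l(1) g])
    have "comp_map X (comp_map Y g l) f = g"
    proof (rule whdts_map_eqI[OF whdts_map_comp[OF w(1) f gl] g])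
      show "fst (comp_map X (comp_map Y g l) f) s = fst g s" if "s \<in> states X" for s
        using that by (simp add: comp_map_apply whdts_map_mem[OF f] lf)
      fix u assume u: "u \<in> actions X"
      then obtain \<alpha> \<beta> where t: "(\<alpha>, [u], \<beta>) \<in> transitions X"
        using cubical_action_step[OF CTS_cubical[OF D(1)]] by blast
      then have "(\<alpha>, [snd l (snd f u)], \<beta>) \<in> transitions X"
        using whdts_mapD(4)[OF l(1) whdts_mapD(4)[OF f t]] weak_hdtsD(2)[OF w(1) t] lf by simp
      then have "snd g (snd l (snd f u)) = snd g u"
        using whdts_mapD(4)[OF g] t by (intro det) fastforce+
      then show "snd (comp_map X (comp_map Y g l) f) u = snd g u"
        using u by (simp add: comp_map_apply whdts_map_mem[OF f])
    qed
    then show "\<exists>h. whdts_map Y Z h \<and> comp_map X h f = g"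
      using gl by blast
  next
    fix h h' assume h: "whdts_map Y Z h" "whdts_map Y Z h'" "comp_map X h f = comp_map X h' f"
    have "comp_map Y (comp_map X h'' f) l = h''" if "whdts_map Y Z h''" for h''
      by (simp add: comp_map_assoc[OF l(1)] l(2) comp_map_id[OF that])
    then show "h = h'"
      using h by metis
  qed
qed

text \<open>A map \<open>P -> Z\<close> is a pair of maps on \<open>Y\<close> and \<open>W\<close>
  agreeing on \<open>X\<close>. Since maps \<open>X -> Z\<close> extend uniquely along
  \<open>f\<close>, the part on \<open>Y\<close> is determined by the part on
  \<open>W\<close>.\<close>

lemma pushout_inverted_by:
  assumes Z: "Z \<in> CTS" and f: "(X, f, Y) \<in> inverted_by Z" and po: "is_pushout X f Y g W h k P"
  shows "(W, k, P) \<in> inverted_by Z"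
proof -
  have arr: "(X, g, W) \<in> CTS_arrows" "(Y, h, P) \<in> CTS_arrows" "(W, k, P) \<in> CTS_arrows"
    and comm: "comp_map X h f = comp_map X k g"
    and univ: "\<And>Q h' k'. (Y, h', Q) \<in> CTS_arrows \<Longrightarrow> (W, k', Q) \<in> CTS_arrows \<Longrightarrow>
        comp_map X h' f = comp_map X k' g \<Longrightarrow>
        \<exists>!l. whdts_map P Q l \<and> comp_map Y l h = h' \<and> comp_map W l k = k'"
    using po unfolding is_pushout_def by blast+
  note m = arr[THEN CTS_arrowsD(3)] and D = arr[THEN CTS_arrowsD(1)]
  note f' = CTS_arrowsD[OF inverted_byD(1)[OF f]]
  have arrow: "(A, a, Z) \<in> CTS_arrows" if "A \<in> CTS" "whdts_map A Z a" for A a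
    using that Z by (simp add: CTS_arrows_def)
  show ?thesis
  proof (rule inverted_byI[OF arr(3)])
    fix k' assume k': "whdts_map W Z k'"
    have "whdts_map X Z (comp_map X k' g)"
      by (rule whdts_map_comp[OF CTS_weak_hdts[OF D(1)] m(1) k'])
    then obtain h' where "whdts_map Y Z h'" "comp_map X h' f = comp_map X k' g"
      using inverted_byD(2)[OF f] by blast
    then show "\<exists>l. whdts_map P Z l \<and> comp_map W l k = k'"
      using univ[OF arrow arrow] D k' by blast
  next
    fix l l' assume l: "whdts_map P Z l" "whdts_map P Z l'" "comp_map W l k = comp_map W l' k"
    have Yl: "whdts_map Y Z (comp_map Y l'' h)" and Wl: "whdts_map W Z (comp_map W l'' k)"
      and sq: "comp_map X (comp_map Y l'' h) f = comp_map X (comp_map W l'' k) g"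
      if "whdts_map P Z l''" for l''
      using whdts_map_comp CTS_weak_hdts D m that
      by (blast, blast) (simp add: comp_map_assoc[OF f'(3)] comp_map_assoc[OF m(1)] comm)
    have "comp_map Y l h = comp_map Y l' h"
      by (rule inverted_byD(3)[OF f Yl[OF l(1)] Yl[OF l(2)]]) (simp add: sq l)
    then show "l = l'"
      using univ[OF arrow[OF D(2) Yl[OF l(1)]] arrow[OF D(3) Wl[OF l(1)]] sq[OF l(1)]] l by metis
  qed
qed

text \<open>\<open>Hom(C, Z)\<close> is the limit of the sets \<open>Hom(D m, Z)\<close>, and each
  of these restricts bijectively to \<open>Hom(D j, Z)\<close>.\<close>

lemma chain_colimit_inverted_by:
  fixes C :: "('u, 'u, 'l) whdts"
  assumes Z: "Z \<in> CTS" and seq: "is_lambda_sequence r D \<phi>" and J: "J \<subseteq> Field r"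
    and col: "is_colimit J D (chain_maps r \<phi> J) C \<iota>" and j: "j \<in> J"
    and inv: "\<And>m. m \<in> J \<Longrightarrow> (j, m) \<in> r \<and> (D j, \<phi> j m, D m) \<in> inverted_by Z"
  shows "(D j, \<iota> j, C) \<in> inverted_by Z"
proof -
  note arr = is_lambda_sequenceD(2)[OF seq, THEN CTS_arrowsD(3)]
  note comp = is_lambda_sequenceD(4)[OF seq]
  note coc = is_cocone_chain[OF is_colimitD(2)[OF col]]
  have CTS_D: "D i \<in> CTS" if "i \<in> J" for i
    using inv[OF that] by (blast dest: inverted_byD(1) CTS_arrowsD(2))
  have jm: "(j, m) \<in> r" and inv': "(D j, \<phi> j m, D m) \<in> inverted_by Z" if "m \<in> J" for m
    using inv[OF that] by blast+
  note id = is_lambda_sequenceD(3)[OF seq, of j]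
  show ?thesis
  proof (rule inverted_byI)
    show "(D j, \<iota> j, C) \<in> CTS_arrows"
      using CTS_D coc(1) is_colimitD(1)[OF col] j by (simp add: CTS_arrows_def)
  next
    fix g assume g: "whdts_map (D j) Z g"
    have "\<forall>m \<in> J. \<exists>h. whdts_map (D m) Z h \<and> comp_map (D j) h (\<phi> j m) = g"
      using inverted_byD(2)[OF inv' g] by blast
    then obtain \<gamma> where \<gamma>: "\<And>m. m \<in> J \<Longrightarrow> whdts_map (D m) Z (\<gamma> m)"
      "\<And>m. m \<in> J \<Longrightarrow> comp_map (D j) (\<gamma> m) (\<phi> j m) = g"
      by metis
    have "is_cocone J D (chain_maps r \<phi> J) Z \<gamma>"
    proof (rule is_cocone_chainI)
      fix i i' assume i: "i \<in> J" "i' \<in> J" "(i, i') \<in> r"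
      show "comp_map (D i) (\<gamma> i') (\<phi> i i') = \<gamma> i"
      \<comment> \<open>Restriction along \<open>\<phi> j i\<close> is injective, so compatibility
        can be checked on \<open>D j\<close>, where both sides are \<open>g\<close>.\<close>
      proof (rule inverted_byD(3)[OF inv'[OF i(1)] _ \<gamma>(1)[OF i(1)]])
        show "whdts_map (D i) Z (comp_map (D i) (\<gamma> i') (\<phi> i i'))"
          by (rule whdts_map_comp[OF CTS_weak_hdts[OF CTS_D[OF i(1)]] arr[OF i(3)] \<gamma>(1)[OF i(2)]])
        show "comp_map (D j) (comp_map (D i) (\<gamma> i') (\<phi> i i')) (\<phi> j i) =
            comp_map (D j) (\<gamma> i) (\<phi> j i)"
          by (simp add: comp_map_assoc[OF arr[OF jm[OF i(1)]]] comp[OF jm[OF i(1)] i(3)] \<gamma>(2) i)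
      qed
    qed (rule \<gamma>(1))
    then obtain h where h: "whdts_map C Z h" "\<forall>i \<in> J. comp_map (D i) h (\<iota> i) = \<gamma> i"
      using is_colimitD(3)[OF col Z] by blast
    have "\<gamma> j = g"
      using \<gamma>(2)[OF j] id j J comp_map_id(1)[OF \<gamma>(1)[OF j]] by auto
    then show "\<exists>h. whdts_map C Z h \<and> comp_map (D j) h (\<iota> j) = g"
      using h j by blast
  next
    fix h h' assume h: "whdts_map C Z h" and h': "whdts_map C Z h'"
      and eq: "comp_map (D j) h (\<iota> j) = comp_map (D j) h' (\<iota> j)"
    have mp: "whdts_map (D m) Z (comp_map (D m) k (\<iota> m))" if "m \<in> J" "whdts_map C Z k" for m k
      by (rule whdts_map_comp[OF CTS_weak_hdts[OF CTS_D[OF that(1)]] coc(1)[OF that(1)] that(2)])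
    have r: "comp_map (D i) (comp_map (D m) k (\<iota> m)) (\<phi> i m) = comp_map (D i) k (\<iota> i)"
      if "i \<in> J" "m \<in> J" "(i, m) \<in> r" for i m k
      using that by (simp add: comp_map_assoc[OF arr[OF that(3)]] coc(2))
    have "comp_map (D m) h (\<iota> m) = comp_map (D m) h' (\<iota> m)" if m: "m \<in> J" for m
      by (rule inverted_byD(3)[OF inv'[OF m] mp[OF m h] mp[OF m h']]) (simp add: r[OF j m jm[OF m]] eq)
    moreover have "is_cocone J D (chain_maps r \<phi> J) Z (\<lambda>m. comp_map (D m) h (\<iota> m))"
      by (rule is_cocone_chainI) (use mp h r in blast)+
    ultimately show "h = h'"
      using is_colimitD(4)[OF col Z _ h _ h'] by simp
  qed
qed

lemma localizer_inverted_by: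
  fixes Z :: "('u, 'u, 'l) whdts"
  assumes inf: "infinite (UNIV :: 'u set)" and Z: "Z \<in> CTS"
    and det: "\<And>\<alpha> u v \<beta>. (\<alpha>, [u], \<beta>) \<in> transitions Z \<Longrightarrow> (\<alpha>, [v], \<beta>) \<in> transitions Z \<Longrightarrow> u = v"
  shows "localizer cofibrations (inverted_by Z)"
proof -
  let ?K = "cofibrations \<inter> inverted_by Z"
  have cof: "(X, f, Y) \<in> ?K \<longleftrightarrow> (X, f, Y) \<in> inverted_by Z \<and> inj_on (snd f) (actions X)" for X f Y
    using inverted_byD(1)[of X f Y Z] by (auto simp: cofibrations_def)
  have po: "closed_under_pushout ?K"
    unfolding closed_under_pushout_def cof
    using pushout_inverted_by[OF Z] pushout_inj_on_actions[OF inf] by blast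
  have "closed_under_transfinite_composition ?K"
  proof (rule closed_under_transfinite_compositionI)
    fix X :: "('u, 'u, 'l) whdts" assume X: "X \<in> CTS"
    then have "(X, id_map X, X) \<in> CTS_arrows"
      using whdts_map_id CTS_weak_hdts by (auto simp: CTS_arrows_def)
    then have "(X, id_map X, X) \<in> inverted_by Z"
      by (rule inverted_byI) (use comp_map_id(1) in metis)+
    then show "(X, id_map X, X) \<in> ?K"
      unfolding cof by (auto simp: inj_on_def id_map_apply)
  next
    fix X f Y g W assume f: "(X, f, Y) \<in> ?K" and g: "(Y, g, W) \<in> ?K"
    then have arr: "(X, f, Y) \<in> CTS_arrows" "(Y, g, W) \<in> CTS_arrows"
      by (auto simp: cofibrations_def)
    have "(X, comp_map X g f, W) \<in> inverted_by Z"
      using two_out_of_three_inverted_by[of Z] arr f g unfolding two_out_of_three_def by blast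
    moreover have "inj_on (snd (comp_map X g f)) (actions X)"
      using f g whdts_map_mem(2)[OF CTS_arrowsD(3)[OF arr(1)]]
      unfolding cof by (auto simp: inj_on_def comp_map_apply)
    ultimately show "(X, comp_map X g f, W) \<in> ?K"
      unfolding cof by blast
  next
    fix r :: "'u rel" and D \<phi> J \<iota> j and C :: "('u, 'u, 'l) whdts"
    assume *: "is_lambda_sequence r D \<phi>" "J \<subseteq> Field r" "is_colimit J D (chain_maps r \<phi> J) C \<iota>"
      "j \<in> J" and K: "\<And>m. m \<in> J \<Longrightarrow> (j, m) \<in> r \<and> (D j, \<phi> j m, D m) \<in> ?K"
    show "(D j, \<iota> j, C) \<in> ?K"
      using chain_colimit_inverted_by[OF Z *] chain_colimit_inj_on_actions[OF inf *] K
      unfolding cof by blast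
  qed
  moreover have "w \<in> inverted_by Z" if "w \<in> CTS_arrows" "has_rlp cofibrations w" for w
    using that by (cases w) (auto intro: has_rlp_cofibrations_inverted det)
  moreover have "inverted_by Z \<subseteq> CTS_arrows"
    by (auto simp: inverted_by_def)
  ultimately show ?thesis
    using two_out_of_three_inverted_by[of Z] po unfolding localizer_def by blast
qed

section \<open>The cubification of the double transition\<close>

lemma map_from_edge:
  assumes X: "weak_hdts X" and t: "(s, [a], t) \<in> transitions X" and a: "label X a = x"
  shows "whdts_map (cube [x]) X
    (restrict (\<lambda>\<epsilon>. if \<epsilon> ! 0 then t else s) (states (cube [x])), restrict (\<lambda>_. a) (actions (cube [x])))"
    (is "whdts_map _ _ ?c")
proof (rule whdts_mapI)
  fix \<epsilon> us \<epsilon>' assume "(\<epsilon>, us, \<epsilon>') \<in> transitions (cube [x])"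
  then have "\<epsilon> = [False]" "us = [(x, 0)]" "\<epsilon>' = [True]"
    unfolding cube_singleton_transitions by simp_all
  then show "(fst ?c \<epsilon>, map (snd ?c) us, fst ?c \<epsilon>') \<in> transitions X"
    using t by (simp add: cube_sel)
qed (use weak_hdtsD(2)[OF X t] a in \<open>auto simp: cube_def\<close>)

text \<open>Sending each cube over \<open>X\<close> to the loop of its component is a cocone, and
  the universal property yields \<open>q : C -> Z\<close>. If \<open>q = h o p\<close>, then
  \<open>h\<close> must send the edges of the two components to different loops, although both edges
  carry the single action \<open>a\<close> of \<open>X\<close>.\<close>

lemma counit_not_inverted:
  fixes x :: 'l
    and X C :: "('u, 'u, 'l) whdts"
    and \<iota> :: "('u, 'u, 'l) cube_over \<Rightarrow> (bool list, 'l \<times> nat, 'u, 'u) map_pair"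
    and p :: "('u, 'u, 'u, 'u) map_pair"
  assumes "infinite (UNIV :: 'u set)"
    and "X \<in> CTS" and "isomorphic X (double_transition x)"
    and "is_cubification X C \<iota>"
    and "is_counit X C \<iota> p"
  obtains Z :: "('u, 'u, 'l) whdts"
  where "Z \<in> CTS" "(C, p, X) \<notin> inverted_by Z"
    "\<And>\<alpha> u v \<beta>. (\<alpha>, [u], \<beta>) \<in> transitions Z \<Longrightarrow> (\<alpha>, [v], \<beta>) \<in> transitions Z \<Longrightarrow> u = v"
proof -
  let ?DT = "double_transition x"
  have DT: "states ?DT = {1, 2, 3, 4}" "actions ?DT = {x}" "label ?DT x = x"
    "transitions ?DT = {(1, [x], 2), (3, [x], 4)}"
    by (simp_all add: double_transition_def)
  note wX = CTS_weak_hdts[OF assms(2)]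
  obtain F G where F: "whdts_map X ?DT F" and G: "whdts_map ?DT X G"
    and GF: "comp_map X G F = id_map X" and FG: "comp_map ?DT F G = id_map ?DT"
    using assms(3) unfolding isomorphic_def by blast
  define a where "a = snd G x"
  have a: "a \<in> actions X" "label X a = x"
    using whdts_map_mem(2)[OF G, of x] whdts_mapD(3)[OF G, of x] by (simp_all add: DT a_def)
  have act: "u = a" if "u \<in> actions X" for u
    using whdts_map_mem(2)[OF F that] comp_map_apply(2)[OF that, of G F] that
    by (simp add: GF DT a_def id_map_apply)
  obtain e\<^sub>0 e\<^sub>1 :: 'u where e: "e\<^sub>0 \<noteq> e\<^sub>1"
    using assms(1) by (metis finite.simps UNIV_eq_I singletonI)
  \<comment> \<open>A cube over \<open>X\<close> lies in a single component of \<open>X\<close>; \<open>\<kappa>\<close> names it.\<close>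
  define \<kappa> where "\<kappa> s = (if fst F s \<in> {1, 2} then e\<^sub>0 else e\<^sub>1)" for s
  have \<kappa>_step: "\<kappa> \<beta> = \<kappa> \<alpha>" if "(\<alpha>, us, \<beta>) \<in> transitions X" for \<alpha> us \<beta>
    using whdts_mapD(4)[OF F that] by (auto simp: DT \<kappa>_def)
  have \<kappa>_cube: "\<kappa> (fst c \<epsilon>) = \<kappa> (fst c (origin xs))"
    if c: "whdts_map (cube xs) X c" and \<epsilon>: "\<epsilon> \<in> states (cube xs)" for xs c \<epsilon>
  proof (cases "\<epsilon> = origin xs")
    case False
    then obtain us where "(origin xs, us, \<epsilon>) \<in> transitions (cube xs)"
      using cube_transition_from_origin \<epsilon> by (auto simp: cube_sel)
    then show ?thesis
      using \<kappa>_step whdts_mapD(4)[OF c] by blast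
  qed simp
  \<comment> \<open>Since \<open>b = id\<close>, the action \<open>e\<^sub>0\<close> loops at the
    state \<open>e\<^sub>0\<close> and \<open>e\<^sub>1\<close> at \<open>e\<^sub>1\<close>, so the
    state of a transition determines its action.\<close>
  define Z where "Z = bouquet {e\<^sub>0, e\<^sub>1} {e\<^sub>0, e\<^sub>1} (\<lambda>_. x) id"
  have Z: "Z \<in> CTS"
    unfolding Z_def using assms(1) by (intro bouquet_in_CTS finite_lesspoll_UNIV) auto
  define \<iota>' :: "('u, 'u, 'l) cube_over \<Rightarrow> (bool list, 'l \<times> nat, 'u, 'u) map_pair"
    where "\<iota>' = (\<lambda>(xs, c).
    (restrict (\<lambda>_. \<kappa> (fst c (origin xs))) (states (cube xs)),
     restrict (\<lambda>_. \<kappa> (fst c (origin xs))) (actions (cube xs))))"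
  have "is_cocone (cubes_over X) (\<lambda>(xs, c). cube xs) (cubes_over_maps X) Z \<iota>'"
    unfolding is_cocone_def
  proof (intro conjI ballI; clarify)
    fix xs c0 c1 assume "(xs, c0, c1) \<in> cubes_over X"
    then have c: "whdts_map (cube xs) X (c0, c1)"
      by (simp add: cubes_over_def)
    show "whdts_map (cube xs) Z (\<iota>' (xs, c0, c1))"
    proof (rule whdts_mapI)
      fix u assume u: "u \<in> actions (cube xs)"
      \<comment> \<open>The only action of \<open>X\<close> is \<open>a\<close>, of label
        \<open>x\<close>, so every direction of a cube over \<open>X\<close> is labelled
        \<open>x\<close> like the loops of \<open>Z\<close>.\<close>
      have "label (cube xs) u = x"
        using whdts_mapD(3)[OF c u] act[OF whdts_map_mem(2)[OF c u]] a by simp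
      then show "label Z (snd (\<iota>' (xs, c0, c1)) u) = label (cube xs) u"
        using u by (simp add: \<iota>'_def Z_def \<kappa>_def)
    next
      fix \<epsilon> us \<epsilon>' assume "(\<epsilon>, us, \<epsilon>') \<in> transitions (cube xs)"
      then obtain js where "us = map (\<lambda>i. (xs ! i, i)) js" "js \<noteq> []"
        "\<epsilon> \<in> states (cube xs)" "\<epsilon>' \<in> states (cube xs)" "set us \<subseteq> actions (cube xs)"
        by (rule cube_transitionE)
      then show "(fst (\<iota>' (xs, c0, c1)) \<epsilon>, map (snd (\<iota>' (xs, c0, c1))) us, fst (\<iota>' (xs, c0, c1)) \<epsilon>')
          \<in> transitions Z"
        by (auto simp: \<iota>'_def Z_def \<kappa>_def subset_iff)
    qed (auto simp: \<iota>'_def Z_def \<kappa>_def)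
  next
    fix ys d0 d1 \<phi>0 \<phi>1 xs c0 c1
    assume "((ys, d0, d1), (\<phi>0, \<phi>1), (xs, c0, c1)) \<in> cubes_over_maps X"
    then have c: "whdts_map (cube xs) X (c0, c1)" and \<phi>: "whdts_map (cube ys) (cube xs) (\<phi>0, \<phi>1)"
      and d: "comp_map (cube ys) (c0, c1) (\<phi>0, \<phi>1) = (d0, d1)"
      by (auto simp: cubes_over_maps_def)
    have o: "origin ys \<in> states (cube ys)"
      by (simp add: cube_sel)
    \<comment> \<open>A map of cubes need not preserve the origin; \<open>\<kappa>_cube\<close>
      carries the value from the image of one origin to the other.\<close>
    then have "\<kappa> (d0 (origin ys)) = \<kappa> (c0 (origin xs))"
      using \<kappa>_cube[OF c whdts_map_mem(1)[OF \<phi> o]] comp_map_apply(1)[OF o, of "(c0, c1)" "(\<phi>0, \<phi>1)"]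
      by (simp add: d)
    then show "comp_map (cube ys) (\<iota>' (xs, c0, c1)) (\<phi>0, \<phi>1) = \<iota>' (ys, d0, d1)"
      using whdts_map_mem[OF \<phi>] by (auto simp: \<iota>'_def comp_map_def compose_def fun_eq_iff)
  qed
  then obtain q where q: "whdts_map C Z q"
    "\<And>xs c. (xs, c) \<in> cubes_over X \<Longrightarrow> comp_map (cube xs) q (\<iota> (xs, c)) = \<iota>' (xs, c)"
    using is_colimitD(3)[OF assms(4)[unfolded is_cubification_def] Z] by fastforce
  \<comment> \<open>Composing \<open>h o p = q\<close> with the cocone turns
    \<open>p o \<iota>\<close> into the cube \<open>c\<close> itself, so \<open>h\<close> can be
    evaluated on cubes of \<open>X\<close>.\<close>
  have hc: "comp_map (cube xs) h c = \<iota>' (xs, c)"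
    if h: "comp_map C h p = q" and "(xs, c) \<in> cubes_over X" for h xs c
  proof -
    have \<iota>: "whdts_map (cube xs) C (\<iota> (xs, c))"
      using is_colimitD(2)[OF assms(4)[unfolded is_cubification_def]] that(2)
      unfolding is_cocone_def by fastforce
    have "comp_map (cube xs) p (\<iota> (xs, c)) = c"
      using assms(5) that(2) unfolding is_counit_def by fastforce
    then show ?thesis
      using comp_map_assoc[OF \<iota>, of h p] q(2)[OF that(2)] by (simp add: h)
  qed
  have ha: "snd h a = \<kappa> (fst G s)"
    if h: "comp_map C h p = q" and t: "(s, [x], t) \<in> transitions ?DT" for h s t
  proof -
    have "(fst G s, [a], fst G t) \<in> transitions X"
      using whdts_mapD(4)[OF G t] by (simp add: a_def)
    note c = map_from_edge[OF wX this a(2)]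
    let ?c = "(restrict (\<lambda>\<epsilon>. if \<epsilon> ! 0 then fst G t else fst G s) (states (cube [x])),
      restrict (\<lambda>_. a) (actions (cube [x])))"
    have u: "(x, 0) \<in> actions (cube [x])"
      by (simp add: cube_sel)
    have "snd h a = snd (comp_map (cube [x]) h ?c) (x, 0)"
      by (simp add: comp_map_apply(2)[OF u] u)
    also have "comp_map (cube [x]) h ?c = \<iota>' ([x], ?c)"
      using c by (intro hc[OF h]) (simp add: cubes_over_def)
    also have "snd \<dots> (x, 0) = \<kappa> (fst G s)"
      using u by (simp add: \<iota>'_def cube_sel(1))
    finally show ?thesis .
  qed
  have "\<kappa> (fst G s) = (if s \<in> {1, 2} then e\<^sub>0 else e\<^sub>1)" if "s \<in> states ?DT" for s
    using comp_map_apply(1)[OF that, of F G] id_map_apply(1)[OF that] by (simp add: FG \<kappa>_def)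
  \<comment> \<open>The edges \<open>1 -> 2\<close> and \<open>3 -> 4\<close> would force
    \<open>snd h a\<close> to be both \<open>e\<^sub>0\<close> and \<open>e\<^sub>1\<close>.\<close>
  then have "comp_map C h p \<noteq> q" for h
    using ha[of h 1 2] ha[of h 3 4] e by (auto simp: DT)
  then have "(C, p, X) \<notin> inverted_by Z"
    using inverted_byD(2)[OF _ q(1)] by blast
  then show ?thesis
    using that[OF Z] by (auto simp: Z_def)
qed

theorem corollary7p11:
  fixes x :: 'l
    and X C :: "('u, 'u, 'l) whdts"
    and \<iota> :: "('u, 'u, 'l) cube_over \<Rightarrow> (bool list, 'l \<times> nat, 'u, 'u) map_pair"
    and p :: "('u, 'u, 'u, 'u) map_pair"
  assumes "infinite (UNIV :: 'u set)"
    and "X \<in> CTS" and "isomorphic X (double_transition x)"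
    and "is_cubification X C \<iota>"
    and "is_counit X C \<iota> p"
  shows "(C, p, X) \<notin> left_determined_weak_equivalences"
proof -
  obtain Z :: "('u, 'u, 'l) whdts" where Z: "Z \<in> CTS" "(C, p, X) \<notin> inverted_by Z"
    "\<And>\<alpha> u v \<beta>. (\<alpha>, [u], \<beta>) \<in> transitions Z \<Longrightarrow> (\<alpha>, [v], \<beta>) \<in> transitions Z \<Longrightarrow> u = v"
    using counit_not_inverted[OF assms] by blast
  have "left_determined_weak_equivalences \<subseteq> inverted_by Z"
    unfolding left_determined_weak_equivalences_def
    by (rule localizer_smallest_localizer(2)[OF localizer_inverted_by[OF assms(1) Z(1,3)]])
  then show ?thesis
    using Z(2) by blast
qed

end
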